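(* Let $F : [1,\infty) \to \mathbb{R}$ be three times continuously differentiable with $$F'(x) > 0, \qquad F''(x) > 0, \qquad F'''(x) < 0 \qquad \text{for all } x \in [1,\infty),$$ and let $a_n = \lfloor F(n) \rfloor$ for $n \geq 1$. Put $\rho_F := \liminf_{N \to \infty} \frac{\log F''(N)}{\log N}$. Then for (Lebesgue) almost all $\alpha \in \mathbb{R}$ the star-discrepancy $D_N^* = D_N^*(\{a_1\alpha\}, \ldots, \{a_N\alpha\})$ of the sequence $(\{a_n \alpha\})_{n \geq 1}$ satisfies $$N D_N^* = \Omega\left(N^{\min\left(\frac14, \frac{1+\rho_F}{2}\right) - \varepsilon}\right) \quad \text{for all } \varepsilon > 0.$$
   Context: $\{x\}$ denotes the fractional part and $\lfloor x \rfloor$ the integer part (floor) of a real number $x$. For points $x_1, \ldots, x_N \in [0,1)$ the star-discrepancy is $D_N^*(x_1,\ldots,x_N) := \sup_{0 < \beta \leq 1} \left| \frac{A_N(\beta)}{N} - \beta \right|$, where $A_N(\beta) := \#\{1 \leq n \leq N : x_n \in [0,\beta)\}$. $f(N) = \Omega(g(N))$ means that there is a constant $c > 0$ with $f(N) \geq c\, g(N)$ for infinitely many $N$. If $\rho_F = -\infty$, then $N^{-\infty}$ is read as $0$. *)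

theory Defs
  imports "HOL-Analysis.Analysis"
begin

text \<open>The points are indexed from 1; only \<open>x 1, \<dots>, x N\<close> matter. For \<open>N = 0\<close> the value is meaningless.\<close>

definition star_discrepancy :: "nat \<Rightarrow> (nat \<Rightarrow> real) \<Rightarrow> real" where
  "star_discrepancy N x =
     (SUP \<beta>\<in>{0<..1}. \<bar>real (card {n \<in> {1..N}. x n \<in> {0..<\<beta>}}) / real N - \<beta>\<bar>)"

text \<open>The lower bound is required for infinitely many \<open>N\<close> only; for nonnegative \<open>f\<close> and \<open>g\<close> this is weaker than
  the big-Omega of the Landau symbol library, which requires it for all large \<open>N\<close>.\<close>

definition io_Omega :: "(nat \<Rightarrow> real) \<Rightarrow> (nat \<Rightarrow> real) \<Rightarrow> bool" where
  "io_Omega f g \<longleftrightarrow> (\<exists>c>0. infinite {N. f N \<ge> c * g N})"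

text \<open>Powers with an extended real exponent, where \<open>N\<close> to the power \<open>-\<infinity>\<close> is 0.
  The exponent \<open>\<infinity>\<close> is not meant to occur.\<close>

definition nat_powr_ereal :: "nat \<Rightarrow> ereal \<Rightarrow> real" where
  "nat_powr_ereal N e = (if e = -\<infinity> then 0 else real N powr real_of_ereal e)"

text \<open>The argument is the second derivative of the function in question. The limit inferior is
  taken in the extended reals, as it may be \<open>-\<infinity>\<close>.\<close>

definition growth_exponent :: "(real \<Rightarrow> real) \<Rightarrow> ereal" where
  "growth_exponent F'' = liminf (\<lambda>N::nat. ereal (ln (F'' (real N)) / ln (real N)))"

end

theory Submission
  imports Defs "HOL-Computational_Algebra.Primes"
begin

text \<open>Let \<open>S(x)\<close> be the sum of \<open>e(a\<^sub>n x)\<close> over \<open>n \<le> N\<close>. By Koksma's inequality, \<open>N D\<^sub>N\<close> at \<open>x\<close> is at least \<open>|S(h x)| / (2 \<pi> h)\<close>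
  for every \<open>h \<ge> 1\<close>. If the \<open>L\<^sup>1\<close> norm of \<open>S\<close> over a period is \<open>I\<close>, then for some level \<open>V\<close> the set where \<open>|S| \<ge> V\<close> has
  measure \<open>\<mu>\<close> with \<open>V \<mu>\<close> almost as large as \<open>I\<close>. A variance estimate, which rests on the divisor bound, shows that for
  most \<open>x\<close> one of the dilates \<open>h x\<close> with \<open>h\<close> not much larger than \<open>1 / \<mu>\<close> falls into this set (up to a small loss in \<open>V\<close>), so that
  \<open>N D\<^sub>N\<close> is almost as large as \<open>I\<close>. Borel-Cantelli along \<open>N = 2\<^sup>L\<close> turns this into a statement for almost all \<open>x\<close>.

  The norm \<open>I\<close> is bounded below by means of the second and the fourth moment of \<open>S\<close>; the latter is the additive energy of the \<open>a\<^sub>n\<close>.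
  The pairs \<open>(k, i)\<close> with \<open>a\<^sub>i - a\<^sub>k = d\<close> form an increasing chain in the square of side \<open>N\<close>, which meets
  only \<open>O(N / P)\<close> boxes of side \<open>P\<close>. By Cauchy-Schwarz the energy is thus controlled by coincidences
  \<open>a\<^sub>k\<^sub>+\<^sub>p - a\<^sub>k = a\<^sub>i\<^sub>+\<^sub>q - a\<^sub>i\<close> with \<open>p, q < P\<close>, and convexity leaves at most \<open>1 + 2 / (q F''(N))\<close> values of \<open>i\<close> for
  given \<open>p\<close>, \<open>q\<close>, \<open>k\<close>. The choice \<open>P \<approx> \<surd>N\<close> gives energy \<open>O(N\<^bsup>5/2\<^esup> + N\<^sup>2 log N / F''(N))\<close>.\<close>

section \<open>Trigonometric polynomials\<close>

definition ee :: "int \<Rightarrow> real \<Rightarrow> complex" where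
  "ee k x = cis (2 * pi * of_int k * x)"

text \<open>One period of \<open>ee\<close>, with total mass 1, so that integrals are mean values
  and measures are probabilities. The cells for all \<open>c\<close> cover the line, which turns
  almost-everywhere statements on each of them into one for \<open>lborel\<close>.\<close>

definition cell :: "int \<Rightarrow> real measure" where
  "cell c = restrict_space lborel {of_int c..of_int c + 1}"

lemma space_cell [simp]: "space (cell c) = {of_int c..of_int c + 1}"
  by (simp add: cell_def space_restrict_space)

lemma measure_cell_space [simp]: "measure (cell c) {of_int c..of_int c + 1} = 1"
  by (simp add: cell_def measure_restrict_space)

lemma finite_measure_cell: "finite_measure (cell c)"
  by standard (simp add: cell_def emeasure_restrict_space space_restrict_space)

interpretation cell: finite_measure "cell c" for c
  by (rule finite_measure_cell)

lemma measurable_cell: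
  assumes "f \<in> borel_measurable borel"
  shows "f \<in> borel_measurable (cell c)"
  using assms by (simp add: cell_def measurable_restrict_space1)

lemma integrable_cell [simp]:
  fixes f :: "real \<Rightarrow> 'b::{banach, second_countable_topology}"
  assumes "continuous_on UNIV f"
  shows "integrable (cell c) f"
proof -
  have "integrable lborel (\<lambda>x. indicator {of_int c..of_int c + 1 :: real} x *\<^sub>R f x)"
    by (intro borel_integrable_compact continuous_on_subset[OF assms]) auto
  then show ?thesis
    by (simp add: cell_def integrable_restrict_space)
qed

lemma integral_cell_const [simp]: "integral\<^sup>L (cell c) (\<lambda>x. k) = (k :: 'b::{banach, second_countable_topology})"
  by simp

lemma continuous_ee [continuous_intros]: "continuous_on A (ee k)"
  unfolding ee_def by (intro continuous_intros)

lemma ee_0 [simp]: "ee 0 x = 1"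
  by (simp add: ee_def)

lemma ee_add: "ee (k + l) x = ee k x * ee l x"
  by (simp add: ee_def cis_mult algebra_simps)

lemma cnj_ee: "cnj (ee k x) = ee (- k) x"
  by (simp add: ee_def cis_cnj)

lemma norm_ee [simp]: "norm (ee k x) = 1"
  by (simp add: ee_def)

lemma ee_scale: "ee k (of_int h * x) = ee (h * k) x"
  by (simp add: ee_def algebra_simps)

text \<open>Orthogonality of the characters: for \<open>k\<close> nonzero the antiderivative
  \<open>?G\<close> has period 1, hence the same value at both ends of the cell.\<close>

lemma integral_ee: "integral\<^sup>L (cell c) (ee k) = (if k = 0 then 1 else 0)"
proof (cases "k = 0")
  case True
  then have "ee k = (\<lambda>x. 1)" by auto
  then show ?thesis using True by simp
next
  case False
  let ?w = "2 * pi * of_int k :: real"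
  have w: "?w \<noteq> 0" using False by simp
  let ?G = "\<lambda>x. ee k x / (\<i> * of_real ?w)"
  have eq: "ee k = (\<lambda>x. exp (\<i> * of_real ?w * of_real x))"
    by (auto simp: ee_def cis_conv_exp mult_ac)
  have der: "(?G has_vector_derivative ee k x) (at x within S)" for x S
  proof -
    have "((\<lambda>z. exp (\<i> * of_real ?w * z) / (\<i> * of_real ?w)) has_field_derivative
            exp (\<i> * of_real ?w * of_real x)) (at (of_real x))"
      using w by (auto intro!: derivative_eq_intros)
    then show ?thesis unfolding eq
      by (rule has_vector_derivative_real_field)
  qed
  have "(\<integral>x. indicator {of_int c..of_int c + 1} x *\<^sub>R ee k x \<partial>lborel) = ?G (of_int c + 1) - ?G (of_int c)"
    by (rule integral_FTC_Icc[OF _ der]) (auto intro!: continuous_intros)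
  also have "?G (of_int c + 1) = ?G (of_int c)"
  proof -
    have "ee k (of_int c + 1) = ee k (of_int c) * cis (2 * pi * of_int k)"
      by (simp add: ee_def cis_mult algebra_simps)
    also have "cis (2 * pi * of_int k) = 1"
      by (rule cis_multiple_2pi) simp
    finally show ?thesis by simp
  qed
  finally show ?thesis using False
    by (simp add: cell_def integral_restrict_space)
qed

section \<open>Mean squares of trigonometric sums with repeated frequencies\<close>

lemma integral_norm_square_trig_sum:
  fixes b :: "'j \<Rightarrow> complex" and f :: "'j \<Rightarrow> int"
  assumes "finite J"
  shows "complex_of_real (\<integral>x. (norm (\<Sum>j\<in>J. b j * ee (f j) x))\<^sup>2 \<partial>cell c) =
    (\<Sum>j\<in>J. \<Sum>l\<in>J. if f j = f l then b j * cnj (b l) else 0)"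
proof -
  have "complex_of_real (\<integral>x. (norm (\<Sum>j\<in>J. b j * ee (f j) x))\<^sup>2 \<partial>cell c)
      = (\<integral>x. complex_of_real ((norm (\<Sum>j\<in>J. b j * ee (f j) x))\<^sup>2) \<partial>cell c)"
    by (rule integral_complex_of_real[symmetric])
  also have "\<dots> = (\<integral>x. (\<Sum>j\<in>J. \<Sum>l\<in>J. (b j * cnj (b l)) * ee (f j - f l) x) \<partial>cell c)"
  proof (intro Bochner_Integration.integral_cong refl)
    fix x
    have "complex_of_real ((norm (\<Sum>j\<in>J. b j * ee (f j) x))\<^sup>2)
      = (\<Sum>j\<in>J. b j * ee (f j) x) * cnj (\<Sum>j\<in>J. b j * ee (f j) x)"
      by (rule complex_norm_square)
    then show "complex_of_real ((norm (\<Sum>j\<in>J. b j * ee (f j) x))\<^sup>2) = 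
        (\<Sum>j\<in>J. \<Sum>l\<in>J. (b j * cnj (b l)) * ee (f j - f l) x)"
      using ee_add[of _ "- _" x] by (simp add: sum_product cnj_ee mult_ac)
  qed
  also have "\<dots> = (\<Sum>j\<in>J. \<Sum>l\<in>J. (b j * cnj (b l)) * (if f j - f l = 0 then 1 else 0))"
    by (subst Bochner_Integration.integral_sum; (intro integrable_cell continuous_intros)?)+
       (simp add: integral_ee)
  finally show ?thesis
    by (simp add: if_distrib cong: if_cong)
qed

text \<open>Frequencies may repeat, so off-diagonal terms survive. Each product is bounded by the
  arithmetic mean of the two squares, and symmetry in \<open>j\<close> and \<open>l\<close> then
  charges every coefficient with the multiplicity of its frequency.\<close>

lemma integral_norm_square_trig_sum_le:
  fixes b :: "'j \<Rightarrow> complex" and f :: "'j \<Rightarrow> int"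
  assumes "finite J"
  shows "(\<integral>x. (norm (\<Sum>j\<in>J. b j * ee (f j) x))\<^sup>2 \<partial>cell c) \<le>
    (\<Sum>j\<in>J. (norm (b j))\<^sup>2 * card {l \<in> J. f l = f j})"
proof -
  let ?P = "\<lambda>j l. if f j = f l then (norm (b j))\<^sup>2 else 0"
  have "(\<integral>x. (norm (\<Sum>j\<in>J. b j * ee (f j) x))\<^sup>2 \<partial>cell c)
     = Re (complex_of_real (\<integral>x. (norm (\<Sum>j\<in>J. b j * ee (f j) x))\<^sup>2 \<partial>cell c))" by simp
  also have "\<dots> = (\<Sum>j\<in>J. \<Sum>l\<in>J. if f j = f l then Re (b j * cnj (b l)) else 0)"
    unfolding integral_norm_square_trig_sum[OF assms] Re_sum by (intro sum.cong refl) auto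
  also have "\<dots> \<le> (\<Sum>j\<in>J. \<Sum>l\<in>J. (?P j l + ?P l j) / 2)"
  proof (intro sum_mono)
    fix j l
    have "Re (b j * cnj (b l)) \<le> norm (b j) * norm (b l)"
      using complex_Re_le_cmod[of "b j * cnj (b l)"] by (simp add: norm_mult)
    also have "\<dots> \<le> ((norm (b j))\<^sup>2 + (norm (b l))\<^sup>2) / 2"
      using sum_squares_bound[of "norm (b j)" "norm (b l)"] by simp
    finally show "(if f j = f l then Re (b j * cnj (b l)) else 0) \<le> (?P j l + ?P l j) / 2"
      by auto
  qed
  also have "\<dots> = ((\<Sum>j\<in>J. \<Sum>l\<in>J. ?P j l) + (\<Sum>j\<in>J. \<Sum>l\<in>J. ?P l j)) / 2"
    by (simp add: sum.distrib sum_divide_distrib add_divide_distrib)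
  also have "(\<Sum>j\<in>J. \<Sum>l\<in>J. ?P l j) = (\<Sum>j\<in>J. \<Sum>l\<in>J. ?P j l)"
    by (rule sum.swap)
  also have "(\<Sum>j\<in>J. \<Sum>l\<in>J. ?P j l) = (\<Sum>j\<in>J. (norm (b j))\<^sup>2 * card {l \<in> J. f l = f j})"
  proof (intro sum.cong refl)
    fix j
    have "(\<Sum>l\<in>J. ?P j l) = (\<Sum>l\<in>{l\<in>J. f l = f j}. (norm (b j))\<^sup>2)"
      using assms by (subst sum.inter_filter) (auto intro!: sum.cong)
    then show "(\<Sum>l\<in>J. ?P j l) = (norm (b j))\<^sup>2 * card {l \<in> J. f l = f j}" by simp
  qed
  finally show ?thesis by simp
qed

text \<open>This is how combinatorial counts enter: for the exponential sum itself the right-hand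
  side is at least the number of terms, and for its square it is the additive energy.\<close>

lemma integral_norm_square_ee_sum:
  fixes f :: "'j \<Rightarrow> int"
  assumes "finite J"
  shows "(\<integral>x. (norm (\<Sum>j\<in>J. ee (f j) x))\<^sup>2 \<partial>cell c) = card {(j, l) \<in> J \<times> J. f j = f l}"
proof -
  have "complex_of_real (\<integral>x. (norm (\<Sum>j\<in>J. ee (f j) x))\<^sup>2 \<partial>cell c)
     = (\<Sum>j\<in>J. \<Sum>l\<in>J. if f j = f l then 1 else 0)"
    using integral_norm_square_trig_sum[OF assms, where b = "\<lambda>_. 1" and f = f and c = c] by (simp cong: if_cong)
  also have "\<dots> = (\<Sum>z\<in>J \<times> J. if f (fst z) = f (snd z) then 1 else 0)"
    by (simp add: sum.cartesian_product case_prod_unfold)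
  also have "\<dots> = (\<Sum>z\<in>{z\<in>J \<times> J. f (fst z) = f (snd z)}. 1)"
    using assms by (intro sum.inter_filter[symmetric]) auto
  also have "\<dots> = of_nat (card {(j, l) \<in> J \<times> J. f j = f l})"
  proof -
    have "{z\<in>J \<times> J. f (fst z) = f (snd z)} = {(j, l) \<in> J \<times> J. f j = f l}" by auto
    then show ?thesis by (simp only: sum_constant mult_1_right)
  qed
  also have "\<dots> = complex_of_real (real (card {(j, l) \<in> J \<times> J. f j = f l}))"
    by (simp only: of_real_of_nat_eq)
  finally show ?thesis by (simp only: of_real_eq_iff)
qed

section \<open>Trigonometric polynomials of bounded degree\<close>

definition trig_poly :: "nat \<Rightarrow> (real \<Rightarrow> complex) \<Rightarrow> bool" where
  "trig_poly D g \<longleftrightarrow> (\<exists>b. g = (\<lambda>x. \<Sum>k\<in>{- int D..int D}. b k * ee k x))"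

lemma trig_poly_ee: "\<bar>k\<bar> \<le> int D \<Longrightarrow> trig_poly D (ee k)"
  unfolding trig_poly_def
  by (rule exI[of _ "\<lambda>l. if l = k then 1 else 0"])
     (auto simp: if_distrib if_distribR abs_le_iff cong: if_cong)

lemma trig_poly_scale: 
  assumes "trig_poly D g"
  shows "trig_poly D (\<lambda>x. z * g x)"
proof -
  from assms obtain b where "g = (\<lambda>x. \<Sum>k\<in>{- int D..int D}. b k * ee k x)"
    by (auto simp: trig_poly_def)
  then show ?thesis unfolding trig_poly_def
    by (intro exI[of _ "\<lambda>k. z * b k"]) (auto simp: sum_distrib_left mult_ac)
qed

lemma trig_poly_add: 
  assumes "trig_poly D g" "trig_poly D h"
  shows "trig_poly D (\<lambda>x. g x + h x)"
proof -
  from assms obtain b b' where "g = (\<lambda>x. \<Sum>k\<in>{- int D..int D}. b k * ee k x)"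
     "h = (\<lambda>x. \<Sum>k\<in>{- int D..int D}. b' k * ee k x)"
    by (auto simp: trig_poly_def)
  then show ?thesis unfolding trig_poly_def
    by (intro exI[of _ "\<lambda>k. b k + b' k"]) (auto simp: sum.distrib ring_distribs)
qed

lemma trig_poly_const: "trig_poly D (\<lambda>x. z)"
  using trig_poly_scale[OF trig_poly_ee[of 0 D], of z] by simp

lemma trig_poly_sum:
  assumes "\<And>i. i \<in> I \<Longrightarrow> trig_poly D (g i)"
  shows "trig_poly D (\<lambda>x. \<Sum>i\<in>I. g i x)"
  using assms by (induction I rule: infinite_finite_induct) (auto intro: trig_poly_add trig_poly_const)

lemma trig_poly_diff:
  assumes "trig_poly D g" "trig_poly D h"
  shows "trig_poly D (\<lambda>x. g x - h x)"
  using trig_poly_add[OF assms(1) trig_poly_scale[OF assms(2), of "-1"]] by simp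

lemma trig_poly_mult:
  assumes "trig_poly D g" "trig_poly E h"
  shows "trig_poly (D + E) (\<lambda>x. g x * h x)"
proof -
  from assms obtain b b' where "g = (\<lambda>x. \<Sum>k\<in>{- int D..int D}. b k * ee k x)"
     "h = (\<lambda>x. \<Sum>k\<in>{- int E..int E}. b' k * ee k x)"
    by (auto simp: trig_poly_def)
  then have eq: "(\<lambda>x. g x * h x) =
    (\<lambda>x. \<Sum>k\<in>{- int D..int D}. \<Sum>l\<in>{- int E..int E}. (b k * b' l) * ee (k + l) x)"
    by (intro ext) (simp only: sum_product, intro sum.cong refl, simp add: ee_add)
  show ?thesis unfolding eq
    by (intro trig_poly_sum trig_poly_scale trig_poly_ee) auto
qed

lemma trig_poly_power: "trig_poly D g \<Longrightarrow> trig_poly (m * D) (\<lambda>x. g x ^ m)"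
  by (induction m) (auto intro: trig_poly_mult trig_poly_const)

lemma trig_poly_cnj:
  assumes "trig_poly D g"
  shows "trig_poly D (\<lambda>x. cnj (g x))"
proof -
  from assms obtain b where b: "g = (\<lambda>x. \<Sum>k\<in>{- int D..int D}. b k * ee k x)"
    by (auto simp: trig_poly_def)
  have eq: "(\<lambda>x. cnj (g x)) = (\<lambda>x. \<Sum>k\<in>{- int D..int D}. cnj (b k) * ee (- k) x)"
    by (auto simp: b cnj_ee)
  show ?thesis unfolding eq
    by (intro trig_poly_sum trig_poly_scale trig_poly_ee) auto
qed

lemma trig_poly_continuous: "trig_poly D g \<Longrightarrow> continuous_on A g"
  by (auto simp: trig_poly_def intro!: continuous_intros)

section \<open>The divisor bound and dilates\<close>

lemma card_divisors_mult_le: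
  fixes a b :: nat
  assumes "a > 0" "b > 0"
  shows "card {d. d dvd a * b} \<le> card {d. d dvd a} * card {d. d dvd b}"
proof -
  have "{d. d dvd a * b} \<subseteq> (\<lambda>(x, y). x * y) ` ({d. d dvd a} \<times> {d. d dvd b})"
  proof
    fix d assume "d \<in> {d. d dvd a * b}"
    then obtain x y where "d = x * y" "x dvd a" "y dvd b" using division_decomp by blast
    then show "d \<in> (\<lambda>(x, y). x * y) ` ({d. d dvd a} \<times> {d. d dvd b})" by auto
  qed
  then have "card {d. d dvd a * b} \<le> card ((\<lambda>(x, y). x * y) ` ({d. d dvd a} \<times> {d. d dvd b}))"
    using assms by (intro card_mono) auto
  also have "\<dots> \<le> card ({d. d dvd a} \<times> {d. d dvd b})"
    using assms by (intro card_image_le) auto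
  finally show ?thesis by (simp add: card_cartesian_product)
qed

lemma card_divisors_prime_power_le:
  fixes p :: nat
  assumes "prime p"
  shows "card {d. d dvd p ^ e} \<le> Suc e"
proof -
  have "{d. d dvd p ^ e} = (\<lambda>i. p ^ i) ` {..e}"
    using divides_primepow_nat[OF assms] by auto
  then show ?thesis using card_image_le[of "{..e}" "\<lambda>i. p ^ i"] by simp
qed

text \<open>Treats the primes below a fixed bound, where a constant factor may be lost. The constant
  comes from \<open>1 + s t \<le> (1 + s) (1 + t)\<close> with
  \<open>s = 1 / (\<gamma> ln 2)\<close>, followed by \<open>1 + t \<le> exp t\<close>.\<close>

lemma Suc_le_const_mult_powr:
  fixes \<gamma> :: real
  assumes "\<gamma> > 0" "p \<ge> 2"
  shows "real (Suc e) \<le> (1 + 1 / (\<gamma> * ln 2)) * (real p ^ e) powr \<gamma>"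
proof -
  have l2: "ln (2::real) > 0" by simp
  let ?t = "\<gamma> * real e * ln 2"
  have t: "?t \<ge> 0" using assms by simp
  have "real (Suc e) = 1 + ?t / (\<gamma> * ln 2)" using assms l2 by (simp add: field_simps)
  also have "\<dots> \<le> (1 + 1 / (\<gamma> * ln 2)) * (1 + ?t)"
    using assms l2 t by (simp add: field_simps)
  also have "\<dots> \<le> (1 + 1 / (\<gamma> * ln 2)) * exp ?t"
    using assms l2 by (intro mult_left_mono exp_ge_add_one_self) auto
  also have "exp ?t = (2 ^ e) powr \<gamma>"
    by (simp add: powr_def ln_realpow mult_ac)
  also have "(1 + 1 / (\<gamma> * ln 2)) * (2 ^ e) powr \<gamma> \<le> (1 + 1 / (\<gamma> * ln 2)) * (real p ^ e) powr \<gamma>"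
    using assms l2 by (intro mult_left_mono powr_mono2 power_mono) auto
  finally show ?thesis .
qed

text \<open>Treats the remaining primes, where no constant may be lost: here
  \<open>p powr \<gamma> \<ge> 2\<close>, and \<open>e + 1 \<le> 2 ^ e\<close>.\<close>

lemma Suc_le_powr_of_large_base:
  fixes \<gamma> :: real
  assumes "\<gamma> > 0" "real p \<ge> 2 powr (1 / \<gamma>)"
  shows "real (Suc e) \<le> (real p ^ e) powr \<gamma>"
proof -
  have p: "real p > 0" using assms powr_gt_zero[of 2 "1/\<gamma>"] by linarith
  have "real (Suc e) \<le> 2 ^ e"
    using less_exp[of e] by (metis Suc_leI of_nat_le_iff of_nat_numeral of_nat_power)
  also have "\<dots> = ((2 powr (1/\<gamma>)) ^ e) powr \<gamma>"
    using assms by (simp add: powr_powr powr_realpow[symmetric] mult.commute)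
  also have "\<dots> \<le> (real p ^ e) powr \<gamma>"
    using assms by (intro powr_mono2 power_mono) auto
  finally show ?thesis .
qed

text \<open>By induction, splitting off the full power of one prime at a time. Only primes below
  \<open>B\<close> cost a factor \<open>K\<close>, and there are at most \<open>B\<close> of them,
  so \<open>K ^ B\<close> serves as the constant.\<close>

lemma card_divisors_le_powr:
  fixes \<gamma> :: real
  assumes \<gamma>: "\<gamma> > 0"
  obtains C where "C \<ge> 1" "\<And>n::nat. n > 0 \<Longrightarrow> real (card {d. d dvd n}) \<le> C * real n powr \<gamma>"
proof -
  define B where "B = nat \<lceil>2 powr (1 / \<gamma>)\<rceil>"
  define K where "K = 1 + 1 / (\<gamma> * ln 2)"
  have K: "K \<ge> 1" using \<gamma> by (simp add: K_def)
  define small where "small n = {p \<in> prime_factors n. p < B}" for n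
  have fin: "finite (small n)" for n unfolding small_def by simp
  have main: "real (card {d. d dvd n}) \<le> K ^ card (small n) * real n powr \<gamma>" if "n > 0" for n
    using that
  proof (induction n rule: less_induct)
    case (less n)
    show ?case
    proof (cases "n = 1")
      case True
      then show ?thesis using K by (simp add: small_def)
    next
      case False
      then obtain p where p: "prime p" "p dvd n"
        using prime_factor_nat by blast
      define e where "e = multiplicity p n"
      obtain m where m: "n = p ^ e * m" "\<not> p dvd m"
        by (rule multiplicity_decompose'[of n p, folded e_def]) (use less.prems p(1) in auto)
      have e: "e > 0" using p m by (cases e) auto
      have p2: "p \<ge> 2" using p prime_ge_2_nat by blast
      have m0: "m > 0" using less.prems m by (cases m) auto
      have mn: "m < n"
        using m(1) m0 one_less_power[of p e] p2 e by simp
      have pf: "prime_factors n = insert p (prime_factors m)"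
        unfolding m(1) using p(1) e m0 p2
        by (subst prime_factors_product) (auto simp: prime_factorization_prime_power)
      have pm: "p \<notin> prime_factors m" using m by auto
      have pe: "real (Suc e) * K ^ card (small m) \<le> K ^ card (small n) * (real p ^ e) powr \<gamma>"
      proof (cases "p < B")
        case True
        then have "small n = insert p (small m)" "p \<notin> small m" using pf pm by (auto simp: small_def)
        then have "card (small n) = Suc (card (small m))" using fin by simp
        then show ?thesis using Suc_le_const_mult_powr[OF \<gamma> p2, of e, folded K_def] K
          by (simp add: mult_ac mult_left_mono)
      next
        case False
        then have "small n = small m" using pf by (auto simp: small_def)
        moreover have "real p \<ge> 2 powr (1 / \<gamma>)" using False by (simp add: B_def not_less nat_le_iff ceiling_le_iff)
        ultimately show ?thesis using Suc_le_powr_of_large_base[OF \<gamma>, of p e] K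
          by (simp add: mult_ac mult_left_mono)
      qed
      have "card {d. d dvd n} \<le> card {d. d dvd p ^ e} * card {d. d dvd m}"
        unfolding m(1) using m0 p2 by (intro card_divisors_mult_le) auto
      also have "\<dots> \<le> Suc e * card {d. d dvd m}"
        using card_divisors_prime_power_le[OF p(1)] by (rule mult_le_mono1)
      finally have "real (card {d. d dvd n}) \<le> real (Suc e) * real (card {d. d dvd m})"
        by (metis of_nat_le_iff of_nat_mult)
      also have "\<dots> \<le> real (Suc e) * (K ^ card (small m) * real m powr \<gamma>)"
        using less.IH[OF mn m0] by (intro mult_left_mono) auto
      also have "\<dots> = (real (Suc e) * K ^ card (small m)) * real m powr \<gamma>" by simp
      also have "\<dots> \<le> (K ^ card (small n) * (real p ^ e) powr \<gamma>) * real m powr \<gamma>"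
        by (intro mult_right_mono pe) auto
      also have "\<dots> = K ^ card (small n) * real n powr \<gamma>"
        by (simp add: m(1) powr_mult mult_ac)
      finally show ?thesis .
    qed
  qed
  have card_small: "card (small n) \<le> B" for n
    using card_mono[of "{..<B}" "small n"] by (auto simp: small_def)
  show ?thesis
  proof (rule that)
    show "K ^ B \<ge> 1" using K by simp
    fix n :: nat assume "n > 0"
    from main[OF this] have "real (card {d. d dvd n}) \<le> K ^ card (small n) * real n powr \<gamma>" .
    also have "\<dots> \<le> K ^ B * real n powr \<gamma>"
      using K card_small by (intro mult_right_mono power_increasing) auto
    finally show "real (card {d. d dvd n}) \<le> K ^ B * real n powr \<gamma>" .
  qed
qed

text \<open>Chebyshev's inequality for the sum \<open>W\<close> of the centred dilates of
  \<open>g\<close>. If all dilates stay below half the mean, then \<open>W \<le> - H G / 2\<close>,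
  while the second moment of \<open>W\<close> is at most \<open>H G \<Delta>\<close>. The bound is
  small as soon as \<open>H\<close> is much larger than \<open>\<Delta> / G\<close>.\<close>

lemma measure_no_large_dilate_le:
  fixes g :: "real \<Rightarrow> real" and H D :: nat and c :: int
  defines "G \<equiv> integral\<^sup>L (cell c) g"
  assumes tp: "trig_poly D (\<lambda>x. complex_of_real (g x))"
    and g0: "\<And>x. 0 \<le> g x" and g1: "\<And>x. g x \<le> 1"
    and G: "G > 0" and H: "H > 0" and \<Delta>: "\<Delta> \<ge> 0"
    and div: "\<And>n. 0 < n \<Longrightarrow> n \<le> H * D \<Longrightarrow> real (card {d. d dvd n}) \<le> \<Delta>"
  shows "measure (cell c) {x \<in> space (cell c). \<forall>h\<in>{1..H}. g (real h * x) < G / 2} \<le> 4 * \<Delta> / (real H * G)"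
proof -
  from tp obtain b where b: "\<And>x. complex_of_real (g x) = (\<Sum>k\<in>{- int D..int D}. b k * ee k x)"
    unfolding trig_poly_def by metis
  have contg: "continuous_on A g" for A
  proof -
    show ?thesis using continuous_on_Re[OF trig_poly_continuous[OF tp, of A]] by simp
  qed
  have b0: "b 0 = complex_of_real G"
  proof -
    have "complex_of_real G = (\<integral>x. complex_of_real (g x) \<partial>cell c)"
      unfolding G_def by (rule integral_complex_of_real[symmetric])
    also have "\<dots> = (\<Sum>k\<in>{- int D..int D}. b k * (if k = 0 then 1 else 0))"
      unfolding b by (subst Bochner_Integration.integral_sum; (intro integrable_cell continuous_intros)?)
         (simp add: integral_ee)
    also have "\<dots> = b 0" by (simp add: if_distrib cong: if_cong)
    finally show ?thesis ..
  qed
  \<comment> \<open>Because \<open>0 \<le> g \<le> 1\<close>, the square of \<open>g\<close> is at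
    most \<open>g\<close>; this gains a factor \<open>G\<close> over the trivial bound 1.\<close>
  have parseval: "(\<Sum>k\<in>{- int D..int D}. (norm (b k))\<^sup>2) \<le> G"
  proof -
    have "complex_of_real (\<Sum>k\<in>{- int D..int D}. (norm (b k))\<^sup>2) =
        complex_of_real (\<integral>x. (norm (\<Sum>k\<in>{- int D..int D}. b k * ee k x))\<^sup>2 \<partial>cell c)"
      by (subst integral_norm_square_trig_sum) (auto simp: complex_norm_square[symmetric])
    then have "(\<Sum>k\<in>{- int D..int D}. (norm (b k))\<^sup>2) = (\<integral>x. (g x)\<^sup>2 \<partial>cell c)"
      unfolding of_real_eq_iff b[symmetric] by simp
    also have "\<dots> \<le> (\<integral>x. g x \<partial>cell c)"
    proof (intro integral_mono integrable_cell continuous_intros contg)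
      fix x show "(g x)\<^sup>2 \<le> g x"
        using g0[of x] g1[of x] by (simp add: power2_eq_square mult_left_le)
    qed
    finally show ?thesis by (simp add: G_def)
  qed
  define J where "J = {1..H} \<times> ({- int D..int D} - {0})"
  define f where "f j = int (fst j) * snd j" for j :: "nat \<times> int"
  \<comment> \<open>\<^term>\<open>W\<close> has mean zero. Its second moment counts the solutions of \<open>h k = h' k'\<close> with weights, hence the divisor bound.\<close>
  define W where "W x = (\<Sum>h\<in>{1..H}. g (real h * x) - G)" for x
  have contW: "continuous_on A W" for A
    unfolding W_def
    by (intro continuous_intros continuous_on_compose2[OF contg[of UNIV]]) auto
  have W: "complex_of_real (W x) = (\<Sum>j\<in>J. b (snd j) * ee (f j) x)" for x
  proof -
    have "complex_of_real (W x) = (\<Sum>h\<in>{1..H}. (\<Sum>k\<in>{- int D..int D}. b k * ee (int h * k) x) - b 0)"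
      unfolding W_def of_real_sum of_real_diff b0 b using ee_scale[of _ "int _" x] by simp
    also have "\<dots> = (\<Sum>h\<in>{1..H}. \<Sum>k\<in>{- int D..int D} - {0}. b k * ee (int h * k) x)"
      by (intro sum.cong refl) (simp add: sum_diff1)
    finally show ?thesis
      by (simp add: J_def f_def sum.cartesian_product case_prod_unfold)
  qed
  \<comment> \<open>A solution \<open>(h', k')\<close> of \<open>h' k' = f j\<close> is determined
    by \<open>h'\<close>, which divides \<open>n = |f j|\<close>. Leaving the frequency 0 out of
    \<open>J\<close> keeps \<open>n\<close> positive.\<close>
  have card_le: "real (card {l \<in> J. f l = f j}) \<le> \<Delta>" if "j \<in> J" for j
  proof -
    obtain h k where hk: "j = (h, k)" by (cases j)
    then have j: "j = (h, k)" "h \<in> {1..H}" "k \<noteq> 0" "\<bar>k\<bar> \<le> int D"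
      using \<open>j \<in> J\<close> by (auto simp: J_def)
    define n where "n = h * nat \<bar>k\<bar>"
    have n: "int n = \<bar>f j\<bar>" by (simp add: n_def f_def j abs_mult)
    have n0: "n > 0" using j by (auto simp: n_def)
    have nD: "n \<le> H * D" unfolding n_def using j by (intro mult_le_mono) auto
    have "card {l \<in> J. f l = f j} \<le> card {d. d dvd n}"
    proof (rule card_inj_on_le[where f = fst])
      show "inj_on fst {l \<in> J. f l = f j}"
      proof (rule inj_onI)
        fix y z assume yz: "y \<in> {l \<in> J. f l = f j}" "z \<in> {l \<in> J. f l = f j}" "fst y = fst z"
        then have "int (fst y) * snd y = int (fst y) * snd z" "fst y > 0"
          by (auto simp: J_def f_def)
        then show "y = z" using yz(3) by (simp add: prod_eq_iff)
      qed
      show "fst ` {l \<in> J. f l = f j} \<subseteq> {d. d dvd n}"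
      proof clarify
        fix h' k' assume "(h', k') \<in> J" "f (h', k') = f j"
        then have "int h' dvd f j" by (metis dvd_triv_left f_def fst_conv)
        then show "fst (h', k') dvd n" by (simp add: n int_dvd_int_iff[symmetric])
      qed
    qed (use n0 in auto)
    also have "real (card {d. d dvd n}) \<le> \<Delta>" by (rule div[OF n0 nD])
    finally show ?thesis by simp
  qed
  have "(\<integral>x. (W x)\<^sup>2 \<partial>cell c) = (\<integral>x. (norm (\<Sum>j\<in>J. b (snd j) * ee (f j) x))\<^sup>2 \<partial>cell c)"
    unfolding W[symmetric] by simp
  also have "\<dots> \<le> (\<Sum>j\<in>J. (norm (b (snd j)))\<^sup>2 * card {l \<in> J. f l = f j})"
    by (rule integral_norm_square_trig_sum_le) (simp add: J_def)
  also have "\<dots> \<le> (\<Sum>j\<in>J. (norm (b (snd j)))\<^sup>2 * \<Delta>)"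
    by (intro sum_mono mult_left_mono card_le) auto
  also have "\<dots> = (\<Sum>h\<in>{1..H}. \<Sum>k\<in>{- int D..int D} - {0}. (norm (b k))\<^sup>2) * \<Delta>"
    unfolding sum_distrib_right[symmetric] J_def
    by (subst sum.cartesian_product) (simp add: case_prod_unfold)
  also have "\<dots> \<le> (real H * G) * \<Delta>"
  proof (intro mult_right_mono \<Delta>)
    have "(\<Sum>k\<in>{- int D..int D} - {0}. (norm (b k))\<^sup>2) \<le> (\<Sum>k\<in>{- int D..int D}. (norm (b k))\<^sup>2)"
      by (intro sum_mono2) auto
    also note parseval
    finally have "(\<Sum>h\<in>{1..H}. \<Sum>k\<in>{- int D..int D} - {0}. (norm (b k))\<^sup>2) \<le> (\<Sum>h\<in>{1..H}. G)"
      by (intro sum_mono)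
    then show "(\<Sum>h\<in>{1..H}. \<Sum>k\<in>{- int D..int D} - {0}. (norm (b k))\<^sup>2) \<le> real H * G"
      by simp
  qed
  finally have var: "(\<integral>x. (W x)\<^sup>2 \<partial>cell c) \<le> real H * G * \<Delta>" .
  have "measure (cell c) {x \<in> space (cell c). \<forall>h\<in>{1..H}. g (real h * x) < G / 2}
      \<le> measure (cell c) {x \<in> space (cell c). \<bar>W x\<bar> \<ge> real H * G / 2}"
  proof (rule cell.finite_measure_mono)
    have [measurable]: "W \<in> borel_measurable (cell c)"
      using contW by (intro measurable_cell borel_measurable_continuous_onI)
    show "{x \<in> space (cell c). \<bar>W x\<bar> \<ge> real H * G / 2} \<in> sets (cell c)" by measurable
    show "{x \<in> space (cell c). \<forall>h\<in>{1..H}. g (real h * x) < G / 2} \<subseteq>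
      {x \<in> space (cell c). \<bar>W x\<bar> \<ge> real H * G / 2}"
    proof clarify
      fix x assume *: "\<forall>h\<in>{1..H}. g (real h * x) < G / 2"
      have "W x \<le> (\<Sum>h\<in>{1..H}. - G / 2)"
        unfolding W_def using * by (intro sum_mono) force
      then show "real H * G / 2 \<le> \<bar>W x\<bar>" by simp
    qed
  qed
  also have "\<dots> \<le> (\<integral>x. (W x)\<^sup>2 \<partial>cell c) / (real H * G / 2)\<^sup>2"
    using G H contW
    by (intro cell.second_moment_method measurable_cell borel_measurable_continuous_onI integrable_cell continuous_intros) auto
  also have "\<dots> \<le> real H * G * \<Delta> / (real H * G / 2)\<^sup>2"
    by (intro divide_right_mono var) auto
  also have "\<dots> = 4 * \<Delta> / (real H * G)"
    using G H by (simp add: power2_eq_square field_simps)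
  finally show ?thesis .
qed

section \<open>Koksma's inequality\<close>

lemma ee_of_int [simp]: "ee k (of_int m) = 1"
  unfolding ee_def by (metis cis_multiple_2pi Ints_mult Ints_of_int mult.assoc)

lemma ee_frac: "ee k (frac x) = ee k x"
proof -
  have "ee k x = ee k (frac x) * ee k (of_int \<lfloor>x\<rfloor>)"
    by (simp only: ee_def cis_mult frac_def) (simp add: algebra_simps)
  then show ?thesis by simp
qed

lemma ee_has_vector_derivative:
  "(ee k has_vector_derivative (\<i> * of_real (2 * pi * of_int k)) * ee k x) (at x within S)"
proof -
  let ?w = "\<i> * complex_of_real (2 * pi * of_int k)"
  have eq: "ee k = (\<lambda>x. exp (?w * of_real x))"
    by (auto simp: ee_def cis_conv_exp mult_ac)
  have "((\<lambda>z. exp (?w * z)) has_field_derivative ?w * exp (?w * of_real x)) (at (of_real x))"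
    by (auto intro!: derivative_eq_intros)
  then show ?thesis unfolding eq
    by (rule has_vector_derivative_real_field)
qed

lemma star_discrepancy_bdd_above:
  assumes "N > 0"
  shows "bdd_above ((\<lambda>\<beta>. \<bar>real (card {n \<in> {1..N}. x n \<in> {0..<\<beta>}}) / real N - \<beta>\<bar>) ` {0<..1})"
proof (rule bdd_aboveI2)
  fix \<beta> :: real assume \<beta>: "\<beta> \<in> {0<..1}"
  let ?A = "card {n \<in> {1..N}. x n \<in> {0..<\<beta>}}"
  have "?A \<le> card {1..N}" by (intro card_mono) auto
  then have "real ?A / real N \<le> 1" "real ?A / real N \<ge> 0" using assms by (auto simp: field_simps)
  then show "\<bar>real ?A / real N - \<beta>\<bar> \<le> 1" using \<beta> unfolding greaterThanAtMost_iff abs_le_iff by linarith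
qed

lemma star_discrepancy_ge:
  assumes "N > 0" "0 < \<beta>" "\<beta> \<le> 1"
  shows "\<bar>real (card {n \<in> {1..N}. x n \<in> {0..<\<beta>}}) - real N * \<beta>\<bar> \<le> real N * star_discrepancy N x"
proof -
  let ?A = "card {n \<in> {1..N}. x n \<in> {0..<\<beta>}}"
  have "\<bar>real ?A / real N - \<beta>\<bar> \<le> star_discrepancy N x"
    unfolding star_discrepancy_def
    using assms star_discrepancy_bdd_above[OF assms(1), of x] by (intro cSUP_upper) auto
  then have "real N * \<bar>real ?A / real N - \<beta>\<bar> \<le> real N * star_discrepancy N x"
    by (intro mult_left_mono) auto
  moreover have "real N * \<bar>real ?A / real N - \<beta>\<bar> = \<bar>real N * (real ?A / real N - \<beta>)\<bar>"
    by (simp add: abs_mult)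
  moreover have "real N * (real ?A / real N - \<beta>) = real ?A - real N * \<beta>"
    using assms by (simp add: field_simps)
  ultimately show ?thesis by simp
qed

lemma star_discrepancy_nonneg: "N > 0 \<Longrightarrow> star_discrepancy N x \<ge> 0"
  using star_discrepancy_ge[of N 1 x] by (smt (verit) of_nat_0_less_iff zero_less_mult_iff mult_less_0_iff)

text \<open>Koksma's inequality: integrate the derivative of \<^term>\<open>ee k\<close> against the counting function.\<close>

lemma norm_ee_sum_le_star_discrepancy:
  assumes N: "N > 0" and k: "k > 0"
  shows "norm (\<Sum>n\<in>{1..N}. ee k (x n)) \<le> 2 * pi * of_int k * (real N * star_discrepancy N (\<lambda>n. frac (x n)))"
proof -
  define y where "y n = frac (x n)" for n
  define D where "D = real N * star_discrepancy N y"
  define w where "w = \<i> * complex_of_real (2 * pi * of_int k)"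
  have w0: "w \<noteq> 0" using k by (simp add: w_def)
  have nw: "norm w = 2 * pi * of_int k" using k by (simp add: w_def norm_mult)
  have y01: "0 \<le> y n" "y n < 1" for n by (auto simp: y_def frac_lt_1)
  define A where "A \<beta> = card {n \<in> {1..N}. y n \<in> {0..<\<beta>}}" for \<beta>
  have ee1 [simp]: "ee k 1 = 1" "ee k 0 = 1" using ee_of_int[of k 1] ee_of_int[of k 0] by simp_all
  have int1: "((\<lambda>\<beta>. if \<beta> \<in> {y n..1} then w * ee k \<beta> else 0) has_integral (1 - ee k (y n))) {0..1}" for n
  proof -
    have "((\<lambda>\<beta>. w * ee k \<beta>) has_integral (ee k 1 - ee k (y n))) {y n..1}"
      using y01[of n] unfolding w_def
      by (intro fundamental_theorem_of_calculus ee_has_vector_derivative) auto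
    then show ?thesis
      using y01[of n] by (subst has_integral_restrict) auto
  qed
  \<comment> \<open>Integration by parts: the increment of the antiderivative over the unit interval
    is 1 because \<open>ee k\<close> is 1 at both ends. The factor \<open>N\<close> will cancel
    against the ones in \<open>1 - ee k (y n)\<close>.\<close>
  have "((\<lambda>\<beta>. (of_real \<beta> * (w * ee k \<beta>))) has_integral
      (of_real 1 * ee k 1 - ee k 1 / w) - (of_real 0 * ee k 0 - ee k 0 / w)) {0..1}"
  proof (rule fundamental_theorem_of_calculus)
    fix \<beta> :: real
    have d: "(ee k has_vector_derivative w * ee k \<beta>) (at \<beta> within {0..1})"
      unfolding w_def by (rule ee_has_vector_derivative)
    have "((\<lambda>\<beta>. of_real \<beta> * ee k \<beta> - ee k \<beta> / w) has_vector_derivative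
       (of_real \<beta> * (w * ee k \<beta>) + 1 * ee k \<beta>) - (w * ee k \<beta>) / w) (at \<beta> within {0..1})"
      by (intro has_vector_derivative_diff has_vector_derivative_mult d has_vector_derivative_divide)
         (auto intro!: derivative_eq_intros)
    then show "((\<lambda>\<beta>. of_real \<beta> * ee k \<beta> - ee k \<beta> / w) has_vector_derivative
       of_real \<beta> * (w * ee k \<beta>)) (at \<beta> within {0..1})"
      using w0 by simp
  qed simp
  then have int2: "((\<lambda>\<beta>. of_real \<beta> * (w * ee k \<beta>)) has_integral 1) {0..1}" by simp
  have "((\<lambda>\<beta>. (\<Sum>n\<in>{1..N}. if \<beta> \<in> {y n..1} then w * ee k \<beta> else 0) - of_nat N * (of_real \<beta> * (w * ee k \<beta>)))
     has_integral (\<Sum>n\<in>{1..N}. 1 - ee k (y n)) - of_nat N * 1) {0..1}"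
    by (intro has_integral_diff has_integral_sum has_integral_mult_right int1 int2) auto
  then have "((\<lambda>\<beta>. of_real (real (A \<beta>) - real N * \<beta>) * (w * ee k \<beta>))
     has_integral (\<Sum>n\<in>{1..N}. 1 - ee k (y n)) - of_nat N * 1) {0..1}"
  \<comment> \<open>The count \<open>A\<close> uses the strict inequality
    \<open>y n < \<beta>\<close>, the integrals above use the closed intervals from
    \<open>y n\<close> on; the two differ only at the points \<open>y n\<close>.\<close>
  proof (rule has_integral_spike_finite[rotated 2])
    show "finite (y ` {1..N})" by simp
    fix \<beta> assume \<beta>: "\<beta> \<in> {0..1} - y ` {1..N}"
    have "(\<Sum>n\<in>{1..N}. if \<beta> \<in> {y n..1} then w * ee k \<beta> else 0) =
      (\<Sum>n\<in>{n\<in>{1..N}. y n \<in> {0..<\<beta>}}. w * ee k \<beta>)"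
      using \<beta> y01 by (subst sum.inter_filter) (auto intro!: sum.cong simp: less_le image_iff)
    then show "of_real (real (A \<beta>) - real N * \<beta>) * (w * ee k \<beta>) =
      (\<Sum>n\<in>{1..N}. if \<beta> \<in> {y n..1} then w * ee k \<beta> else 0) - of_nat N * (of_real \<beta> * (w * ee k \<beta>))"
      by (simp add: A_def algebra_simps)
  qed
  then have "((\<lambda>\<beta>. of_real (real (A \<beta>) - real N * \<beta>) * (w * ee k \<beta>))
     has_integral - (\<Sum>n\<in>{1..N}. ee k (y n))) (cbox 0 1)"
    by (simp add: sum_subtractf)
  then have "norm (- (\<Sum>n\<in>{1..N}. ee k (y n))) \<le> (D * norm w) * measure lborel (cbox 0 (1::real))"
  proof (rule has_integral_bound[rotated])
    show D0: "0 \<le> D * norm w" using star_discrepancy_nonneg[OF N] by (simp add: D_def)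
    fix \<beta> :: real assume "\<beta> \<in> cbox 0 1"
    \<comment> \<open>The supremum in \<open>star_discrepancy\<close> runs over
      \<open>\<beta> > 0\<close>, so \<open>\<beta> = 0\<close> is separate; there both the count
      and \<open>N \<beta>\<close> vanish.\<close>
    then have "\<bar>real (A \<beta>) - real N * \<beta>\<bar> \<le> D"
      using star_discrepancy_ge[OF N, of \<beta> y] star_discrepancy_nonneg[OF N, of y]
      by (cases "\<beta> = 0") (auto simp: A_def D_def)
    then show "norm (of_real (real (A \<beta>) - real N * \<beta>) * (w * ee k \<beta>)) \<le> D * norm w"
      unfolding norm_mult norm_of_real by (simp add: mult_right_mono)
  qed
  then show ?thesis
    by (simp add: nw D_def y_def[abs_def] ee_frac mult_ac)
qed

section \<open>From the mean value of an exponential sum to its dilates\<close>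

definition exp_sum :: "(nat \<Rightarrow> int) \<Rightarrow> nat \<Rightarrow> real \<Rightarrow> complex" where
  "exp_sum a N x = (\<Sum>n\<in>{1..N}. ee (a n) x)"

lemma continuous_exp_sum [continuous_intros]: "continuous_on A (exp_sum a N)"
  unfolding exp_sum_def by (intro continuous_intros)

lemma norm_exp_sum_le: "norm (exp_sum a N x) \<le> real N"
  unfolding exp_sum_def using norm_sum[of "\<lambda>n. ee (a n) x" "{1..N}"] by simp

lemma superlevel_sets_cell [measurable]:
  fixes f :: "real \<Rightarrow> 'b::real_normed_vector"
  assumes "continuous_on UNIV f"
  shows "{x \<in> space (cell c). norm (f x) \<ge> V} \<in> sets (cell c)"
proof -
  have "(\<lambda>x. norm (f x)) \<in> borel_measurable (cell c)"
    using assms by (intro measurable_cell borel_measurable_continuous_onI continuous_intros)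
  then show ?thesis by measurable
qed

text \<open>Pigeonhole over the levels \<open>(I / 2) q\<^sup>i\<close>.\<close>

lemma exists_dominant_level:
  fixes S :: "real \<Rightarrow> complex" and c :: int
  defines "I \<equiv> (\<integral>x. norm (S x) \<partial>cell c)"
  assumes cont: "continuous_on UNIV S" and bound: "\<And>x. norm (S x) \<le> b"
    and I: "I > 0" and q: "q \<ge> 1" and K: "I / 2 * q ^ K > b"
  obtains V where "I / 2 \<le> V" "V \<le> b"
    "V * measure (cell c) {x \<in> space (cell c). norm (S x) \<ge> V} \<ge> I / (2 * real K * q)"
proof -
  define V where "V i = I / 2 * q ^ i" for i
  define L where "L i = {x \<in> space (cell c). norm (S x) \<ge> V i}" for i
  have V0: "V i \<ge> I / 2" for i unfolding V_def using I q by simp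
  have [measurable]: "L i \<in> sets (cell c)" for i
    unfolding L_def by (rule superlevel_sets_cell[OF cont])
  have pos: "K > 0"
  proof (rule ccontr)
    assume "\<not> K > 0"
    then have "b < I / 2" using K by simp
    moreover have "I \<le> (\<integral>x. b \<partial>cell c)"
      unfolding I_def using cont bound by (intro integral_mono integrable_cell continuous_intros) auto
    ultimately show False using I by simp
  qed
  \<comment> \<open>The term \<open>I / 2\<close> covers the points below the lowest level
    \<open>V 0\<close>. At any other point \<open>|S|\<close> lies between \<open>V i\<close> and
    \<open>q * V i\<close> for some \<open>i < K\<close>, since \<open>V K\<close> exceeds
    \<open>b\<close>.\<close>
  have pt: "norm (S x) \<le> I / 2 + (\<Sum>i<K. q * V i * indicat_real (L i) x)" if x: "x \<in> space (cell c)" for x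
  proof (cases "norm (S x) < V 0")
    case True
    then show ?thesis using I q V0
      by (intro order_trans[OF less_imp_le[OF True]] add_increasing2 sum_nonneg) (auto simp: V_def)
  next
    case False
    have "norm (S x) < V K" using bound[of x] K by (simp add: V_def)
    with False obtain i where i: "i < K" "\<not> norm (S x) < V i" "norm (S x) < V (Suc i)"
      using ex_least_nat_less[of "\<lambda>i. norm (S x) < V i" K] by blast
    have "norm (S x) \<le> q * V i * indicat_real (L i) x"
      using i x by (simp add: L_def V_def mult_ac)
    also have "\<dots> \<le> (\<Sum>i<K. q * V i * indicat_real (L i) x)"
      using i q I by (intro member_le_sum) (auto simp: V_def)
    finally show ?thesis using I by linarith
  qed
  have int: "integrable (cell c) (indicat_real (L i))" for i
    by (intro integrable_real_indicator) (auto simp: cell.emeasure_eq_measure)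
  have "I \<le> (\<integral>x. I / 2 + (\<Sum>i<K. q * V i * indicat_real (L i) x) \<partial>cell c)"
    by (subst I_def, intro integral_mono pt)
       (intro integrable_cell continuous_intros cont cell.integrable_const Bochner_Integration.integrable_add
          Bochner_Integration.integrable_sum integrable_mult_right int)+
  also have "\<dots> = (\<integral>x. I / 2 \<partial>cell c) + (\<integral>x. (\<Sum>i<K. q * V i * indicat_real (L i) x) \<partial>cell c)"
    by (intro Bochner_Integration.integral_add cell.integrable_const
          Bochner_Integration.integrable_sum integrable_mult_right int)
  also have "\<dots> = I / 2 + (\<Sum>i<K. q * V i * measure (cell c) (L i))"
  proof -
    have "L i \<inter> {of_int c..of_int c + 1} = L i" for i by (auto simp: L_def)
    then show ?thesis
      by (subst Bochner_Integration.integral_sum) (auto intro!: integrable_mult_right int)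
  qed
  finally have le: "I / 2 \<le> (\<Sum>i<K. q * V i * measure (cell c) (L i))" by simp
  have "\<exists>i<K. q * V i * measure (cell c) (L i) \<ge> I / (2 * real K)"
  proof (rule ccontr)
    assume "\<not> ?thesis"
    then have "(\<Sum>i<K. q * V i * measure (cell c) (L i)) < (\<Sum>i<K. I / (2 * real K))"
      using pos by (intro sum_strict_mono) auto
    then show False using le pos by simp
  qed
  then obtain i where i: "q * V i * measure (cell c) (L i) \<ge> I / (2 * real K)" by blast
  have "V i \<le> b"
  proof (rule ccontr)
    assume "\<not> V i \<le> b"
    then have "L i = {}" unfolding L_def using bound by (force simp: not_le dest: le_less_trans)
    then show False using i I pos by (simp add: field_simps)
  qed
  moreover have "V i * measure (cell c) (L i) \<ge> I / (2 * real K * q)"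
    using i q pos by (simp add: field_simps)
  ultimately show ?thesis using that[of "V i"] V0[of i] by (simp add: L_def)
qed

text \<open>Here \<open>g = (1 - (1 - |S|\<^sup>2 / b\<^sup>2)\<^sup>d)\<^sup>m\<close> replaces the indicator function of the set where \<open>|S| \<ge> V\<close>. Its degree
  is too large for \<open>g\<close> to be of use by itself, but only the logarithm of the degree enters the divisor bound.\<close>

lemma trig_poly_superlevel:
  fixes S :: "real \<Rightarrow> complex" and b V :: real
  defines "d \<equiv> nat \<lceil>b\<^sup>2 / V\<^sup>2\<rceil>"
  assumes S: "trig_poly A S" and bound: "\<And>x. norm (S x) \<le> b" and V: "0 < V" "V \<le> b"
  obtains g :: "real \<Rightarrow> real" where
    "trig_poly (m * (d * (2 * A))) (\<lambda>x. complex_of_real (g x))"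
    "\<And>x. 0 \<le> g x" "\<And>x. g x \<le> 1"
    "\<And>x. norm (S x) \<ge> V \<Longrightarrow> g x \<ge> (1 / 2) ^ m"
    "\<And>x. g x \<le> (2 * ((norm (S x))\<^sup>2 / V\<^sup>2)) ^ m"
proof
  define u where "u x = (norm (S x))\<^sup>2 / b\<^sup>2" for x
  define g where "g x = (1 - (1 - u x) ^ d) ^ m" for x
  have b: "b > 0" using V by simp
  have u: "0 \<le> u x" "u x \<le> 1" for x
    using bound[of x] b by (auto simp: u_def divide_le_eq power_mono)
  have bV: "1 \<le> b\<^sup>2 / V\<^sup>2" using V by (simp add: power_mono)
  have d: "real d \<ge> b\<^sup>2 / V\<^sup>2" "real d \<le> 2 * (b\<^sup>2 / V\<^sup>2)"
    using bV unfolding d_def by linarith+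
  have p: "0 \<le> (1 - u x) ^ d" "(1 - u x) ^ d \<le> 1" for x
    using u[of x] by (auto intro!: power_le_one)
  show "0 \<le> g x" "g x \<le> 1" for x
    unfolding g_def using p[of x] by (auto intro!: power_le_one)
  have "(\<lambda>x. complex_of_real (g x)) =
      (\<lambda>x. (1 - (1 - complex_of_real (1 / b\<^sup>2) * (S x * cnj (S x))) ^ d) ^ m)"
    by (simp add: g_def u_def complex_norm_square[symmetric])
  moreover have "trig_poly (m * (d * (A + A))) \<dots>"
    by (intro trig_poly_power trig_poly_diff trig_poly_const trig_poly_scale trig_poly_mult trig_poly_cnj S)
  ultimately show "trig_poly (m * (d * (2 * A))) (\<lambda>x. complex_of_real (g x))"
    by (simp add: mult_2)
  \<comment> \<open>The choice of \<open>d\<close> gives \<open>d * u x \<ge> 1\<close> where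
    \<open>|S| \<ge> V\<close>, so the inner power is at most \<open>exp (- 1)\<close>.\<close>
  show "g x \<ge> (1 / 2) ^ m" if x: "norm (S x) \<ge> V" for x
  proof -
    have "1 \<le> real d * u x"
    proof -
      have "1 = (b\<^sup>2 / V\<^sup>2) * (V\<^sup>2 / b\<^sup>2)" using V b by simp
      also have "\<dots> \<le> real d * u x"
        unfolding u_def using d V x by (intro mult_mono divide_right_mono power_mono) auto
      finally show ?thesis .
    qed
    have "(1 - u x) ^ d \<le> exp (- u x) ^ d"
      using u[of x] exp_ge_add_one_self[of "- u x"] by (intro power_mono) auto
    also have "\<dots> = exp (- (real d * u x))" by (simp add: exp_of_nat_mult[symmetric])
    also have "\<dots> \<le> exp (- 1)" using \<open>1 \<le> real d * u x\<close> by simp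
    also have "\<dots> \<le> 1 / 2"
      using exp_ge_add_one_self[of 1] by (simp add: exp_minus field_simps)
    finally show ?thesis unfolding g_def by (intro power_mono) auto
  qed
  \<comment> \<open>Bernoulli's inequality shows that \<open>g\<close> is small where
    \<open>|S|\<close> is much smaller than \<open>V\<close>; the power \<open>m\<close> amplifies
    this.\<close>
  show "g x \<le> (2 * ((norm (S x))\<^sup>2 / V\<^sup>2)) ^ m" for x
  proof -
    have "1 - real d * u x \<le> (1 - u x) ^ d"
      using Bernoulli_inequality[of "- u x" d] u[of x] by simp
    then have "1 - (1 - u x) ^ d \<le> real d * u x" by simp
    also have "\<dots> \<le> 2 * (b\<^sup>2 / V\<^sup>2) * u x" using d u by (intro mult_right_mono) auto
    also have "\<dots> = 2 * ((norm (S x))\<^sup>2 / V\<^sup>2)" using b V by (simp add: u_def)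
    finally show ?thesis unfolding g_def using p[of x] by (intro power_mono) auto
  qed
qed

text \<open>The superlevel set at the dominant level \<open>V\<close> has measure
  \<open>\<mu>\<close>, and \<open>g\<close>, with mean \<open>G\<close>, is a polynomial substitute
  for its indicator. About \<open>q\<^sup>2 / G\<close> dilates, where
  \<open>q = N powr \<eta>\<close>, make the exceptional set \<open>O(1 / q)\<close>. The loss
  \<open>4 * \<eta>\<close> consists of one factor \<open>q\<close> from the pigeonhole over levels,
  one from \<open>V / q\<close> in place of \<open>V\<close>, and two from the size of
  \<open>h\<close>.\<close>

lemma large_exp_sum_of_dilate:
  fixes a :: "nat \<Rightarrow> int" and A0 :: nat and \<eta> \<tau> c\<^sub>0 :: real and c :: int
  assumes \<eta>: "0 < \<eta>" "\<eta> \<le> 1" and \<tau>: "\<tau> \<ge> 0" and c0: "0 < c\<^sub>0" "c\<^sub>0 \<le> 1" and A0: "A0 > 0"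
    and a: "\<And>n N. 1 \<le> n \<Longrightarrow> n \<le> N \<Longrightarrow> \<bar>a n\<bar> \<le> int (A0 * N\<^sup>2)"
    and L1: "\<And>N. N \<ge> N\<^sub>0 \<Longrightarrow> (\<integral>x. norm (exp_sum a N x) \<partial>cell c) \<ge> c\<^sub>0 * real N powr \<tau>"
  obtains c\<^sub>1 C N\<^sub>1 where "c\<^sub>1 > 0"
    "\<And>N. N \<ge> N\<^sub>1 \<Longrightarrow> \<exists>B\<in>sets (cell c). measure (cell c) B \<le> C * real N powr (- \<eta>) \<and>
        (\<forall>x\<in>space (cell c) - B. \<exists>h\<ge>1. norm (exp_sum a N (real h * x)) \<ge> c\<^sub>1 * real h * real N powr (\<tau> - 4 * \<eta>))"
proof -
  \<comment> \<open>\<open>K\<close> makes \<open>q ^ K \<ge> N\<^sup>2\<close>, so that the levels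
    climb from \<open>I / 2\<close> beyond \<open>N\<close>; \<open>m\<close> makes
    \<open>q ^ m \<ge> N ^ 3\<close>, which outweighs \<open>1 / G = O(N\<^sup>2)\<close>.\<close>
  define K where "K = nat \<lceil>2 / \<eta>\<rceil>"
  define m where "m = nat \<lceil>3 / \<eta>\<rceil>"
  have K: "real K \<ge> 2 / \<eta>" and m: "real m \<ge> 3 / \<eta>"
    unfolding K_def m_def by linarith+
  have "2 / \<eta> > 0" "3 / \<eta> > 0" using \<eta> by auto
  with K m have K': "\<eta> * real K \<ge> 2" "real K > 0" and m': "\<eta> * real m \<ge> 3" "real m > 0"
    using \<eta> by (simp add: field_simps, linarith)+
  define c2 where "c2 = (1 / 2) ^ m * c\<^sub>0 / (2 * real K)"
  have c2: "c2 > 0" using c0 K' by (simp add: c2_def)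
  define K3 where "K3 = 32 * real m * real A0 / (c\<^sub>0\<^sup>2 * c2)"
  have K3: "K3 > 0" using c2 c0 m' A0 by (simp add: K3_def)
  \<comment> \<open>The divisor bound is applied up to \<open>H * D\<close>, which is
    \<open>O(N ^ 8)\<close>, so that it becomes a constant times \<open>q\<close>.\<close>
  define \<gamma> where "\<gamma> = \<eta> / 8"
  have \<gamma>: "\<gamma> > 0" using \<eta> by (simp add: \<gamma>_def)
  obtain C\<gamma> where C\<gamma>: "C\<gamma> \<ge> 1" "\<And>n::nat. n > 0 \<Longrightarrow> real (card {d. d dvd n}) \<le> C\<gamma> * real n powr \<gamma>"
    using card_divisors_le_powr[OF \<gamma>] by blast
  define C4 where "C4 = C\<gamma> * K3 powr \<gamma>"
  define c1 where "c1 = (1 / 2) ^ m * c\<^sub>0 / (4 * real K)"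
  \<comment> \<open>The third entry gives \<open>c\<^sub>0 / 2 * N > 1\<close>, for the range of the
    levels; the fourth gives \<open>2 ^ m / N ^ 3 < c2 / (2 N\<^sup>2)\<close>, for the
    contradiction in \<open>Sh\<close>.\<close>
  define N1 where "N1 = Max {1, N\<^sub>0, nat \<lceil>2 / c\<^sub>0\<rceil> + 1, nat \<lceil>2 * 2 ^ m / c2\<rceil> + 1}"
  show ?thesis
  proof (rule that)
    show "c1 > 0" using c0 K' by (simp add: c1_def)
    fix N assume "N \<ge> N1"
    then have N: "N \<ge> 1" "N \<ge> N\<^sub>0" "real N > 2 / c\<^sub>0" "real N > 2 * 2 ^ m / c2"
      unfolding N1_def by (auto; linarith)+
    define S where "S = exp_sum a N"
    define I where "I = (\<integral>x. norm (S x) \<partial>cell c)"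
    define q where "q = real N powr \<eta>"
    have q: "1 \<le> q" "q \<le> real N"
      using N \<eta> powr_mono[of \<eta> 1 "real N"] by (auto simp: q_def ge_one_powr_ge_zero)
    have qK: "q ^ K \<ge> (real N)\<^sup>2"
    proof -
      have "(real N)\<^sup>2 = real N powr 2" using N by (simp add: powr_numeral)
      also have "\<dots> \<le> real N powr (\<eta> * real K)" using N K' by (intro powr_mono) auto
      also have "\<dots> = q ^ K" using N by (simp add: q_def powr_powr[symmetric] powr_realpow)
      finally show ?thesis .
    qed
    have qm: "q ^ m \<ge> real N ^ 3"
    proof -
      have "real N ^ 3 = real N powr 3" using N by (simp add: powr_numeral)
      also have "\<dots> \<le> real N powr (\<eta> * real m)" using N m' by (intro powr_mono) auto
      also have "\<dots> = q ^ m" using N by (simp add: q_def powr_powr[symmetric] powr_realpow)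
      finally show ?thesis .
    qed
    have I: "I \<ge> c\<^sub>0 * real N powr \<tau>" using L1[OF N(2)] by (simp add: I_def S_def)
    moreover have "c\<^sub>0 * real N powr \<tau> \<ge> c\<^sub>0 * 1"
      using N c0 \<tau> by (intro mult_left_mono ge_one_powr_ge_zero) auto
    ultimately have I0: "I \<ge> c\<^sub>0" by simp
    have "I / 2 * q ^ K > real N"
    proof -
      have "real N * 1 < real N * (c\<^sub>0 / 2 * real N)"
        using N c0 by (intro mult_strict_left_mono) (auto simp: field_simps)
      also have "\<dots> = c\<^sub>0 / 2 * (real N)\<^sup>2" by (simp add: power2_eq_square)
      also have "\<dots> \<le> I / 2 * q ^ K" using I0 qK c0 by (intro mult_mono) auto
      finally show ?thesis by simp
    qed
    then obtain V where V: "I / 2 \<le> V" "V \<le> real N"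
      "V * measure (cell c) {x \<in> space (cell c). norm (S x) \<ge> V} \<ge> I / (2 * real K * q)"
      using exists_dominant_level[of S "real N" c q K] I0 c0 q norm_exp_sum_le
      by (auto simp: S_def I_def continuous_exp_sum)
    define \<mu> where "\<mu> = measure (cell c) {x \<in> space (cell c). norm (S x) \<ge> V}"
    have Vpos: "V > 0" "V \<ge> c\<^sub>0 / 2" using V(1) I0 c0 by auto
    define d where "d = nat \<lceil>(real N)\<^sup>2 / V\<^sup>2\<rceil>"
    define D where "D = m * (d * (2 * (A0 * N\<^sup>2)))"
    have "trig_poly (A0 * N\<^sup>2) S"
      unfolding S_def exp_sum_def[abs_def] using a[of _ N] by (intro trig_poly_sum trig_poly_ee) auto
    then obtain g where g: "trig_poly D (\<lambda>x. complex_of_real (g x))"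
        "\<And>x. 0 \<le> g x" "\<And>x. g x \<le> 1"
        "\<And>x. norm (S x) \<ge> V \<Longrightarrow> g x \<ge> (1 / 2) ^ m"
        "\<And>x. g x \<le> (2 * ((norm (S x))\<^sup>2 / V\<^sup>2)) ^ m"
      using trig_poly_superlevel[of "A0 * N\<^sup>2" S "real N" V m] Vpos V(2) norm_exp_sum_le
      unfolding D_def d_def S_def by blast
    define G where "G = integral\<^sup>L (cell c) g"
    have contg: "continuous_on UNIV g"
      using continuous_on_Re[OF trig_poly_continuous[OF g(1), of UNIV]] by simp
    have G\<mu>: "G \<ge> (1 / 2) ^ m * \<mu>"
    proof -
      have L: "{x \<in> space (cell c). norm (S x) \<ge> V} \<in> sets (cell c)"
        unfolding S_def by (intro superlevel_sets_cell continuous_exp_sum)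
      have "(1 / 2) ^ m * \<mu> = (\<integral>x. (1 / 2) ^ m * indicat_real {x \<in> space (cell c). norm (S x) \<ge> V} x \<partial>cell c)"
        using L by (simp add: \<mu>_def inf_absorb1 subset_iff)
      also have "\<dots> \<le> G"
        unfolding G_def using L g(2,4) contg
        by (intro integral_mono integrable_mult_right integrable_real_indicator integrable_cell)
           (auto simp: cell.emeasure_eq_measure indicator_def)
      finally show ?thesis .
    qed
    have V\<mu>: "V * \<mu> \<ge> I / (2 * real K * q)" using V(3) by (simp add: \<mu>_def)
    have \<mu>0: "\<mu> \<ge> 0" by (simp add: \<mu>_def)
    \<comment> \<open>A crude bound that replaces both \<open>q\<close> and \<open>V\<close> by
      \<open>N\<close>. It keeps the number of dilates polynomial in \<open>N\<close> and is what
      \<open>q ^ m\<close> has to beat.\<close>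
    have G2: "G \<ge> c2 / (real N)\<^sup>2"
    proof -
      have "c\<^sub>0 / (2 * real K * real N) \<le> I / (2 * real K * q)"
        using I0 c0 K' q N by (intro frac_le mult_left_mono) auto
      also have "\<dots> \<le> V * \<mu>" by (rule V\<mu>)
      also have "\<dots> \<le> real N * \<mu>" using V(2) \<mu>0 by (intro mult_right_mono) auto
      finally have "c\<^sub>0 / (2 * real K) / (real N)\<^sup>2 \<le> \<mu>"
        using N K' by (simp add: field_simps power2_eq_square)
      then have "(1 / 2) ^ m * (c\<^sub>0 / (2 * real K) / (real N)\<^sup>2) \<le> (1 / 2) ^ m * \<mu>"
        by (intro mult_left_mono) auto
      with G\<mu> show ?thesis by (simp add: c2_def)
    qed
    have Gpos: "G > 0" using G2 c2 N by (smt (verit) divide_pos_pos of_nat_0_less_iff zero_less_power less_le_trans le_numeral_extra(3) One_nat_def Suc_le_eq)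
    have G1: "G \<le> 1"
    proof -
      have "G \<le> (\<integral>x. 1 \<partial>cell c)"
        unfolding G_def using g(3) contg by (intro integral_mono integrable_cell) auto
      then show ?thesis by simp
    qed
    define H where "H = nat \<lceil>q\<^sup>2 / G\<rceil>"
    have qG: "q\<^sup>2 / G \<ge> 1"
    proof -
      have "G \<le> q\<^sup>2" using G1 q by (smt (verit) one_le_power)
      then show ?thesis using Gpos by simp
    qed
    have H: "real H \<ge> q\<^sup>2 / G" "real H \<le> 2 * (q\<^sup>2 / G)"
      using qG unfolding H_def by linarith+
    have H0: "H > 0" using H qG by (cases H) auto
    have HD: "real (H * D) \<le> K3 * real N ^ 8"
    proof -
      have "1 \<le> (real N)\<^sup>2 / V\<^sup>2"
        using V(2) Vpos by (simp add: power_mono)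
      then have "real d \<le> 2 * ((real N)\<^sup>2 / V\<^sup>2)" unfolding d_def by linarith
      also have "\<dots> \<le> 2 * ((real N)\<^sup>2 / (c\<^sub>0 / 2)\<^sup>2)"
        using Vpos c0 by (intro mult_left_mono divide_left_mono power_mono mult_pos_pos) auto
      also have "\<dots> = 8 * (real N)\<^sup>2 / c\<^sub>0\<^sup>2" using c0 by (simp add: power2_eq_square)
      finally have d: "real d \<le> 8 * (real N)\<^sup>2 / c\<^sub>0\<^sup>2" .
      have "real H \<le> 2 * ((real N)\<^sup>2 / (c2 / (real N)\<^sup>2))"
        using q c2 N G2 Gpos
        by (intro order_trans[OF H(2)] mult_left_mono frac_le power_mono) auto
      also have "\<dots> = 2 * real N ^ 4 / c2" using N c2 by (simp add: field_simps power_numeral_reduce)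
      finally have "real H * real D \<le> (2 * real N ^ 4 / c2) * (real m * ((8 * (real N)\<^sup>2 / c\<^sub>0\<^sup>2) * (2 * (real A0 * (real N)\<^sup>2))))"
        unfolding D_def of_nat_mult of_nat_power of_nat_numeral using d c2
        by (intro mult_mono mult_left_mono mult_right_mono) auto
      also have "\<dots> = K3 * real N ^ 8"
        using c2 c0 by (simp add: K3_def field_simps power_numeral_reduce)
      finally show ?thesis by simp
    qed
    define \<Delta> where "\<Delta> = C4 * q"
    have \<Delta>: "real (card {d. d dvd n}) \<le> \<Delta>" if n: "0 < n" "n \<le> H * D" for n
    proof -
      have "real n \<le> K3 * real N ^ 8" using n(2) HD by linarith
      then have "real n powr \<gamma> \<le> (K3 * real N ^ 8) powr \<gamma>"
        using \<gamma> by (intro powr_mono2) auto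
      also have "\<dots> = K3 powr \<gamma> * q"
        using K3 N by (simp add: powr_mult q_def \<gamma>_def powr_powr flip: powr_numeral)
      finally have "C\<gamma> * real n powr \<gamma> \<le> \<Delta>"
        using C\<gamma>(1) by (simp add: \<Delta>_def C4_def mult.assoc mult_left_mono)
      with C\<gamma>(2)[OF n(1)] show ?thesis by linarith
    qed
    have \<Delta>0: "\<Delta> \<ge> 0" using C\<gamma>(1) q by (simp add: \<Delta>_def C4_def)
    define B where "B = {x \<in> space (cell c). \<forall>h\<in>{1..H}. g (real h * x) < G / 2}"
    have "B \<in> sets (cell c)"
    proof -
      have [measurable]: "(\<lambda>x. g (real h * x)) \<in> borel_measurable (cell c)" for h
        by (intro measurable_cell borel_measurable_continuous_onI continuous_on_compose2[OF contg] continuous_intros) auto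
      show ?thesis unfolding B_def by measurable
    qed
    moreover have "measure (cell c) B \<le> 4 * C4 * real N powr (- \<eta>)"
    proof -
      have "measure (cell c) B \<le> 4 * \<Delta> / (real H * G)"
        unfolding B_def G_def using g(1-3) Gpos H0 \<Delta>0 \<Delta>
        by (intro measure_no_large_dilate_le[where D = D]) (auto simp: G_def)
      also have "\<dots> \<le> 4 * \<Delta> / q\<^sup>2"
        using H Gpos q \<Delta>0 by (intro divide_left_mono mult_pos_pos) (auto simp: field_simps H0)
      also have "\<dots> = 4 * C4 / q" using q by (simp add: \<Delta>_def power2_eq_square)
      also have "\<dots> = 4 * C4 * real N powr (- \<eta>)" by (simp add: q_def powr_minus divide_inverse)
      finally show ?thesis .
    qed
    moreover have "\<exists>h\<ge>1. norm (exp_sum a N (real h * x)) \<ge> c1 * real h * real N powr (\<tau> - 4 * \<eta>)"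
      if "x \<in> space (cell c) - B" for x
    proof -
      from that obtain h where h: "1 \<le> h" "h \<le> H" "g (real h * x) \<ge> G / 2"
        unfolding B_def by force
      \<comment> \<open>If \<open>|S| < V / q\<close> at this point, then
        \<open>g \<le> (2 / q) ^ m\<close>, because
        \<open>(V / q)\<^sup>2 \<le> V\<^sup>2 / q\<close>; this falls below
        \<open>G / 2\<close>.\<close>
      have Sh: "norm (S (real h * x)) \<ge> V / q"
      proof (rule ccontr)
        assume "\<not> ?thesis"
        then have "(norm (S (real h * x)))\<^sup>2 \<le> (V / q)\<^sup>2" by (intro power_mono) auto
        also have "\<dots> \<le> V\<^sup>2 / q"
          using q Vpos by (simp add: power_divide power2_eq_square field_simps)
        finally have "(norm (S (real h * x)))\<^sup>2 / V\<^sup>2 \<le> 1 / q" using Vpos q by (simp add: field_simps)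
        then have "(2 * ((norm (S (real h * x)))\<^sup>2 / V\<^sup>2)) ^ m \<le> (2 * (1 / q)) ^ m"
          by (intro power_mono mult_left_mono) auto
        with g(5)[of "real h * x"] h(3) have "G / 2 \<le> (2 * (1 / q)) ^ m" by linarith
        also have "\<dots> = 2 ^ m / q ^ m" by (simp add: power_divide)
        also have "\<dots> \<le> 2 ^ m / real N ^ 3" using qm N q by (intro divide_left_mono mult_pos_pos) auto
        also have "\<dots> < c2 / 2 / (real N)\<^sup>2"
          using N(1,4) c2 by (simp add: field_simps power2_eq_square power3_eq_cube)
        also have "\<dots> \<le> G / 2" using G2 by simp
        finally show False by simp
      qed
      have "c1 * real N powr (\<tau> - 4 * \<eta>) = (1 / 2) ^ m * (c\<^sub>0 * real N powr \<tau>) / (4 * real K * q ^ 4)"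
        using N by (simp add: c1_def q_def powr_diff powr_powr mult.commute flip: powr_numeral)
      also have "\<dots> \<le> (1 / 2) ^ m * I / (4 * real K * q ^ 4)"
        using I q by (intro divide_right_mono mult_left_mono) auto
      also have "\<dots> = (1 / 2) ^ m * (I / (2 * real K * q)) / (2 * q ^ 3)"
        using q by (simp add: power_numeral_reduce)
      also have "\<dots> \<le> (1 / 2) ^ m * (V * \<mu>) / (2 * q ^ 3)"
        using q by (intro divide_right_mono mult_left_mono V\<mu>) auto
      also have "\<dots> = V * ((1 / 2) ^ m * \<mu>) / (2 * q ^ 3)" by simp
      also have "\<dots> \<le> V * G / (2 * q ^ 3)"
        using q Vpos by (intro divide_right_mono mult_left_mono G\<mu>) auto
      also have "\<dots> = (V / q) / (2 * (q\<^sup>2 / G))"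
        using q Gpos by (simp add: field_simps power_numeral_reduce)
      also have "\<dots> \<le> norm (S (real h * x)) / real h"
        using Sh h H Vpos q by (intro frac_le) auto
      finally show ?thesis using h(1)
        by (intro exI[of _ h]) (simp add: S_def field_simps)
    qed
    ultimately show "\<exists>B\<in>sets (cell c). measure (cell c) B \<le> 4 * C4 * real N powr (- \<eta>) \<and>
        (\<forall>x\<in>space (cell c) - B. \<exists>h\<ge>1. norm (exp_sum a N (real h * x)) \<ge> c1 * real h * real N powr (\<tau> - 4 * \<eta>))"
      by blast
  qed
qed

section \<open>Almost all points, by Borel-Cantelli along powers of two\<close>

lemma ee_swap: "ee k (real h * x) = ee (int h) (of_int k * x)"
  by (simp add: ee_def mult_ac)

lemma AE_lborel_of_AE_cell:
  assumes "\<And>c. AE x in cell c. P x"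
  shows "AE x in lborel. P x"
proof -
  have "AE x in lborel. x \<in> {of_int c..of_int c + 1 :: real} \<longrightarrow> P x" for c :: int
    using assms[of c] unfolding cell_def by (subst (asm) AE_restrict_space_iff) auto
  then have "AE x in lborel. \<forall>c::int. x \<in> {of_int c..of_int c + 1 :: real} \<longrightarrow> P x"
    by (subst AE_all_countable) blast
  then show ?thesis
  proof eventually_elim
    case (elim x)
    from elim[rule_format, of "\<lfloor>x\<rfloor>"] show ?case by simp
  qed
qed

text \<open>Along \<open>N = 2 ^ L\<close> the exceptional measures are dominated by a geometric
  series, so almost every point is eventually outside. The factor \<open>h\<close> in the size of
  the sum at \<open>h x\<close> compensates the factor \<open>h\<close> lost in Koksma's
  inequality.\<close>

lemma AE_io_Omega_of_L1:
  fixes a :: "nat \<Rightarrow> int" and A0 :: nat and \<eta> \<tau> c\<^sub>0 :: real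
  assumes \<eta>: "0 < \<eta>" "\<eta> \<le> 1" and \<tau>: "\<tau> \<ge> 0" and c0: "0 < c\<^sub>0" "c\<^sub>0 \<le> 1" and A0: "A0 > 0"
    and a: "\<And>n N. 1 \<le> n \<Longrightarrow> n \<le> N \<Longrightarrow> \<bar>a n\<bar> \<le> int (A0 * N\<^sup>2)"
    and L1: "\<And>c N. N \<ge> N\<^sub>0 \<Longrightarrow> (\<integral>x. norm (exp_sum a N x) \<partial>cell c) \<ge> c\<^sub>0 * real N powr \<tau>"
  shows "AE \<alpha> in lborel. io_Omega (\<lambda>N. real N * star_discrepancy N (\<lambda>n. frac (of_int (a n) * \<alpha>)))
                    (\<lambda>N. real N powr (\<tau> - 4 * \<eta>))"
proof (rule AE_lborel_of_AE_cell)
  fix c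
  obtain c1 C N1 where c1: "c1 > 0" and *:
    "\<And>N. N \<ge> N1 \<Longrightarrow> \<exists>B\<in>sets (cell c). measure (cell c) B \<le> C * real N powr (- \<eta>) \<and>
        (\<forall>x\<in>space (cell c) - B. \<exists>h\<ge>1. norm (exp_sum a N (real h * x)) \<ge> c1 * real h * real N powr (\<tau> - 4 * \<eta>))"
    using large_exp_sum_of_dilate[OF \<eta> \<tau> c0 A0 a L1[where c = c]] by metis
  define good where "good N x \<longleftrightarrow> (\<exists>h\<ge>1. norm (exp_sum a N (real h * x)) \<ge> c1 * real h * real N powr (\<tau> - 4 * \<eta>))" for N x
  have "\<exists>B\<in>sets (cell c). measure (cell c) B \<le> C * real (2 ^ L) powr (- \<eta>) \<and>
        (\<forall>x\<in>space (cell c) - B. good (2 ^ L) x)" if "L \<ge> N1" for L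
    using *[of "2 ^ L"] that less_exp[of L] by (simp add: good_def)
  then obtain B where B: "\<And>L. L \<ge> N1 \<Longrightarrow> B L \<in> sets (cell c)"
     "\<And>L. L \<ge> N1 \<Longrightarrow> measure (cell c) (B L) \<le> C * real (2 ^ L) powr (- \<eta>)"
     "\<And>L x. L \<ge> N1 \<Longrightarrow> x \<in> space (cell c) - B L \<Longrightarrow> good (2 ^ L) x"
    by metis
  have "summable (\<lambda>L. measure (cell c) (B (L + N1)))"
  proof (rule summable_comparison_test')
    have "summable (\<lambda>L. (2 powr (- \<eta>)) ^ L)"
      using \<eta> by (intro summable_geometric) (simp add: powr_less_one)
    then show "summable (\<lambda>L. C * (2 powr (- \<eta>)) ^ (L + N1))"
      by (simp add: power_add summable_mult summable_mult2)
    show "norm (measure (cell c) (B (L + N1))) \<le> C * (2 powr (- \<eta>)) ^ (L + N1)" for L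
      using B(2)[of "L + N1"] by (simp add: powr_power mult.commute flip: powr_realpow) (simp add: powr_powr mult.commute)
  qed
  then have "AE x in cell c. eventually (\<lambda>L. x \<in> space (cell c) - B (L + N1)) sequentially"
    by (intro borel_cantelli_AE1 B) (auto simp: cell.emeasure_eq_measure)
  then show "AE \<alpha> in cell c. io_Omega (\<lambda>N. real N * star_discrepancy N (\<lambda>n. frac (of_int (a n) * \<alpha>)))
                    (\<lambda>N. real N powr (\<tau> - 4 * \<eta>))"
  proof eventually_elim
    case (elim x)
    then obtain L0 where L0: "\<And>L. L \<ge> L0 \<Longrightarrow> x \<in> space (cell c) - B (L + N1)"
      by (auto simp: eventually_sequentially)
    let ?ND = "\<lambda>N. real N * star_discrepancy N (\<lambda>n. frac (of_int (a n) * x))"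
    have *: "?ND N \<ge> c1 / (2 * pi) * real N powr (\<tau> - 4 * \<eta>)" if "good N x" "N > 0" for N
    proof -
      from that obtain h where h: "h \<ge> 1" "norm (exp_sum a N (real h * x)) \<ge> c1 * real h * real N powr (\<tau> - 4 * \<eta>)"
        by (auto simp: good_def)
      \<comment> \<open>The sum at \<open>h x\<close> with frequencies \<open>a n\<close> is read as
        the sum with the single frequency \<open>h\<close> over the points \<open>a n * x\<close>,
        the form that Koksma's inequality takes.\<close>
      have "c1 * real h * real N powr (\<tau> - 4 * \<eta>) \<le> norm (\<Sum>n\<in>{1..N}. ee (int h) (of_int (a n) * x))"
        using h by (simp add: exp_sum_def ee_swap)
      also have "\<dots> \<le> 2 * pi * of_int (int h) * ?ND N"
        using h that by (intro norm_ee_sum_le_star_discrepancy) auto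
      finally have "real h * (c1 * real N powr (\<tau> - 4 * \<eta>)) \<le> real h * (2 * pi * ?ND N)"
        by (simp add: mult_ac)
      then have "c1 * real N powr (\<tau> - 4 * \<eta>) \<le> 2 * pi * ?ND N"
        using h by (subst (asm) mult_le_cancel_left_pos) auto
      then show ?thesis by (simp add: field_simps)
    qed
    have "(\<lambda>L. 2 ^ L) ` {L0 + N1..} \<subseteq> {N. ?ND N \<ge> c1 / (2 * pi) * real N powr (\<tau> - 4 * \<eta>)}"
    proof (rule image_subsetI)
      fix L assume "L \<in> {L0 + N1..}"
      then have "L \<ge> N1" "L = (L - N1) + N1" "L - N1 \<ge> L0" by auto
      then have "good (2 ^ L) x" using B(3)[of L x] L0[of "L - N1"] by metis
      then have "c1 / (2 * pi) * real (2 ^ L) powr (\<tau> - 4 * \<eta>) \<le> ?ND (2 ^ L)"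
        by (rule *) simp
      then show "2 ^ L \<in> {N. ?ND N \<ge> c1 / (2 * pi) * real N powr (\<tau> - 4 * \<eta>)}"
        by (rule CollectI)
    qed
    moreover have "infinite ((\<lambda>L. 2 ^ L :: nat) ` {L0 + N1..})"
      by (subst finite_image_iff) (auto simp: inj_on_def infinite_Ici)
    ultimately have "infinite {N. ?ND N \<ge> c1 / (2 * pi) * real N powr (\<tau> - 4 * \<eta>)}"
      using finite_subset by blast
    then show ?case unfolding io_Omega_def using c1
      by (intro exI[of _ "c1 / (2 * pi)"]) auto
  qed
qed

section \<open>Additive energy of convex sequences\<close>

lemma card_fibre_pairs:
  assumes "finite X"
  shows "card {(y, z) \<in> X \<times> X. f y = f z} = (\<Sum>d\<in>f ` X. (card {y \<in> X. f y = d})\<^sup>2)"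
proof -
  have "{(y, z) \<in> X \<times> X. f y = f z} = (\<Union>d\<in>f ` X. {y \<in> X. f y = d} \<times> {y \<in> X. f y = d})"
    by auto
  also have "card \<dots> = (\<Sum>d\<in>f ` X. card ({y \<in> X. f y = d} \<times> {y \<in> X. f y = d}))"
    using assms by (intro card_UN_disjoint) auto
  finally show ?thesis by (simp add: card_cartesian_product power2_eq_square)
qed

text \<open>Cauchy-Schwarz: refining the fibres of f by a label g with at most m values costs a factor \<open>m\<close>.\<close>

lemma card_fibre_pairs_le_refinement:
  assumes "finite X" and g: "g ` X \<subseteq> {..<m}"
  shows "card {(y, z) \<in> X \<times> X. f y = f z} \<le> m * card {(y, z) \<in> X \<times> X. f y = f z \<and> g y = (g z :: nat)}"
proof -
  have "real (card {(y, z) \<in> X \<times> X. f y = f z}) = (\<Sum>d\<in>f ` X. (real (card {y \<in> X. f y = d}))\<^sup>2)"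
    unfolding card_fibre_pairs[OF assms(1)] by simp
  also have "\<dots> \<le> (\<Sum>d\<in>f ` X. real m * (\<Sum>b<m. (real (card {y \<in> X. f y = d \<and> g y = b}))\<^sup>2))"
  proof (intro sum_mono)
    fix d
    have "{y \<in> X. f y = d} = (\<Union>b<m. {y \<in> X. f y = d \<and> g y = b})" using g by auto
    also have "card \<dots> = (\<Sum>b<m. card {y \<in> X. f y = d \<and> g y = b})"
      using assms(1) by (intro card_UN_disjoint) auto
    finally have "real (card {y \<in> X. f y = d}) = (\<Sum>b<m. 1 * real (card {y \<in> X. f y = d \<and> g y = b}))"
      by simp
    then have "(real (card {y \<in> X. f y = d}))\<^sup>2 \<le> (\<Sum>b<m. 1\<^sup>2) * (\<Sum>b<m. (real (card {y \<in> X. f y = d \<and> g y = b}))\<^sup>2)"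
      by (simp only: Cauchy_Schwarz_ineq_sum)
    then show "(real (card {y \<in> X. f y = d}))\<^sup>2 \<le> real m * (\<Sum>b<m. (real (card {y \<in> X. f y = d \<and> g y = b}))\<^sup>2)"
      by simp
  qed
  also have "\<dots> = real m * (\<Sum>(d, b)\<in>f ` X \<times> {..<m}. (real (card {y \<in> X. (f y, g y) = (d, b)}))\<^sup>2)"
    unfolding sum.cartesian_product[symmetric] sum_distrib_left[symmetric] by simp
  also have "(\<Sum>(d, b)\<in>f ` X \<times> {..<m}. (real (card {y \<in> X. (f y, g y) = (d, b)}))\<^sup>2) =
      (\<Sum>e\<in>(\<lambda>y. (f y, g y)) ` X. (real (card {y \<in> X. (f y, g y) = e}))\<^sup>2)"
  proof (rule sum.mono_neutral_cong_right)
    show "(\<lambda>y. (f y, g y)) ` X \<subseteq> f ` X \<times> {..<m}" using g by auto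
    show "\<forall>i\<in>f ` X \<times> {..<m} - (\<lambda>y. (f y, g y)) ` X. (case i of (d, b) \<Rightarrow> (real (card {y \<in> X. (f y, g y) = (d, b)}))\<^sup>2) = 0"
    proof clarify
      fix x b assume "(f x, b) \<notin> (\<lambda>y. (f y, g y)) ` X"
      then have "{y \<in> X. (f y, g y) = (f x, b)} = {}" by (auto simp: image_iff)
      then show "(real (card {y \<in> X. (f y, g y) = (f x, b)}))\<^sup>2 = 0" by (simp only: card.empty) simp
    qed
  qed (use assms in auto)
  also have "\<dots> = real (card {(y, z) \<in> X \<times> X. f y = f z \<and> g y = g z})"
    using card_fibre_pairs[OF assms(1), of "\<lambda>y. (f y, g y)"] unfolding prod.inject by simp
  finally show ?thesis unfolding of_nat_mult[symmetric] of_nat_le_iff .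
qed

text \<open>The gaps \<open>p\<close> and \<open>q\<close> stand first because the count fixes them
  first; \<open>k\<close> and \<open>i\<close> are the lower end points. The cutoff \<open>M\<close>
  leaves out an initial stretch on which the floors of \<open>F\<close> may repeat.\<close>

definition short_gap_coincidences :: "(nat \<Rightarrow> int) \<Rightarrow> nat \<Rightarrow> nat \<Rightarrow> nat \<Rightarrow> ((nat \<times> nat) \<times> nat \<times> nat) set" where
  "short_gap_coincidences a M N P =
     {((p, q), k, i). p \<in> {1..<P} \<and> q \<in> {1..<P} \<and> M < k \<and> k + p \<le> N \<and> M < i \<and> i + q \<le> N \<and> a (k + p) - a k = a (i + q) - a i}"

lemma finite_short_gap_coincidences: "finite (short_gap_coincidences a M N P)"
  by (rule finite_subset[of _ "({1..<P} \<times> {1..<P}) \<times> ({..N} \<times> {..N})"])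
     (auto simp: short_gap_coincidences_def)

text \<open>Cauchy-Schwarz over the block labels \<open>g\<close>, which take at most
  \<open>2 * (N div P) + 1\<close> values. Among pairs with equal difference and equal label, the
  diagonal ones number at most \<open>N\<^sup>2\<close>; each other one is a short-gap coincidence,
  read in one of two orders.\<close>

lemma additive_energy_le:
  fixes a :: "nat \<Rightarrow> int"
  assumes mono: "strict_mono_on {M<..N} a" and P: "P > 0"
  defines "X \<equiv> {M<..N} \<times> {M<..N}"
  shows "card {(y, z) \<in> X \<times> X. a (fst y) + a (snd y) = a (fst z) + a (snd z)}
     \<le> (2 * (N div P) + 1) * (N\<^sup>2 + 2 * card (short_gap_coincidences a M N P))"
proof -
  define f where "f y = a (snd y) - a (fst y)" for y
  \<comment> \<open>On a fibre of \<^term>\<open>f\<close>, larger \<open>k\<close> go with larger \<open>i\<close>, so equal labels force equal \<open>k div P\<close> and equal \<open>i div P\<close>.\<close>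
  define g where "g y = fst y div P + snd y div P" for y :: "nat \<times> nat"
  define Q where "Q = short_gap_coincidences a M N P"
  have fin: "finite X" by (simp add: X_def)
  have finQ: "finite Q" unfolding Q_def by (rule finite_short_gap_coincidences)
  have amono: "a x < a y \<longleftrightarrow> x < y" "a x \<le> a y \<longleftrightarrow> x \<le> y" if "x \<in> {M<..N}" "y \<in> {M<..N}" for x y
    using mono that by (auto simp: strict_mono_on_less strict_mono_on_less_eq)
  have "card {(y, z) \<in> X \<times> X. a (fst y) + a (snd y) = a (fst z) + a (snd z)} =
    card {(y, z) \<in> X \<times> X. f y = f z}"
  \<comment> \<open>The equation
    \<open>a y\<^sub>1 + a y\<^sub>2 = a z\<^sub>1 + a z\<^sub>2\<close> is rearranged to
    \<open>a y\<^sub>1 - a z\<^sub>1 = a z\<^sub>2 - a y\<^sub>2\<close>.\<close>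
  proof (rule bij_betw_same_card[of "\<lambda>(y, z). ((fst z, fst y), (snd y, snd z))"])
    show "bij_betw (\<lambda>(y, z). ((fst z, fst y), (snd y, snd z)))
      {(y, z) \<in> X \<times> X. a (fst y) + a (snd y) = a (fst z) + a (snd z)} {(y, z) \<in> X \<times> X. f y = f z}"
      by (rule bij_betwI[where g = "\<lambda>(y, z). ((snd y, fst z), (fst y, snd z))"]) (auto simp: X_def f_def)
  qed
  also have "\<dots> \<le> (2 * (N div P) + 1) * card {(y, z) \<in> X \<times> X. f y = f z \<and> g y = g z}"
  proof (intro card_fibre_pairs_le_refinement fin)
    show "g ` X \<subseteq> {..<2 * (N div P) + 1}"
    proof (rule image_subsetI)
      fix y assume "y \<in> X"
      then have "fst y div P \<le> N div P" "snd y div P \<le> N div P" by (auto simp: X_def intro: div_le_mono)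
      then show "g y \<in> {..<2 * (N div P) + 1}" by (simp add: g_def)
    qed
  qed
  also have "(2 * (N div P) + 1) * card {(y, z) \<in> X \<times> X. f y = f z \<and> g y = g z}
      \<le> (2 * (N div P) + 1) * (N\<^sup>2 + 2 * card Q)"
  proof (rule mult_le_mono2)
    let ?E = "{(y, z) \<in> X \<times> X. f y = f z \<and> g y = g z}"
    let ?up = "\<lambda>((p, q), k, i). ((k, i), (k + p, i + q)) :: (nat \<times> nat) \<times> nat \<times> nat"
    let ?dn = "\<lambda>((p, q), k, i). ((k + p, i + q), (k, i)) :: (nat \<times> nat) \<times> nat \<times> nat"
    have close: "y' < y + P" if "y div P = y' div P" for y y'
    proof -
      have "y' < y' div P * P + P"
        using div_mult_mod_eq[of y' P] mod_less_divisor[OF P, of y'] by linarith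
      also have "\<dots> \<le> y + P" unfolding that[symmetric] by simp
      finally show ?thesis .
    qed
    have up: "\<exists>w\<in>Q. ((k, i), (k', i')) = ?up w"
      if "(k, i) \<in> X" "(k', i') \<in> X" "f (k, i) = f (k', i')" "g (k, i) = g (k', i')" "k < k'" for k i k' i'
    proof -
      from that have "a k < a k'" using amono by (auto simp: X_def)
      then have "a i < a i'" using that by (simp add: f_def)
      then have "i < i'" using that amono by (auto simp: X_def)
      have "k div P \<le> k' div P" "i div P \<le> i' div P"
        using \<open>k < k'\<close> \<open>i < i'\<close> by (auto intro: div_le_mono)
      \<comment> \<open>Neither block index can decrease, and equal labels mean that their sum stays
        the same, so neither changes.\<close>
      then have eq: "k div P = k' div P" "i div P = i' div P"
        using that(4) by (simp_all add: g_def)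
      have "k' < k + P" "i' < i + P"
        by (rule close, fact)+
      then have "((k' - k, i' - i), k, i) \<in> Q"
        using that \<open>k < k'\<close> \<open>i < i'\<close> by (auto simp: Q_def short_gap_coincidences_def X_def f_def)
      then show ?thesis using \<open>k < k'\<close> \<open>i < i'\<close> by (intro bexI[of _ "((k' - k, i' - i), k, i)"]) auto
    qed
    have "?E \<subseteq> (\<lambda>y. (y, y)) ` X \<union> (?up ` Q \<union> ?dn ` Q)"
    proof (rule subsetI)
      fix v assume "v \<in> ?E"
      moreover obtain k i k' i' where v: "v = ((k, i), (k', i'))" by (metis surj_pair)
      ultimately have *: "(k, i) \<in> X" "(k', i') \<in> X" "f (k, i) = f (k', i')" "g (k, i) = g (k', i')" by auto
      consider "k < k'" | "k' < k" | "k = k'" by linarith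
      then show "v \<in> (\<lambda>y. (y, y)) ` X \<union> (?up ` Q \<union> ?dn ` Q)"
      proof cases
        case 1
        obtain w where "w \<in> Q" "((k, i), (k', i')) = ?up w" using up[OF * 1] by (rule bexE)
        then show ?thesis using v by blast
      next
        case 2
        obtain w where "w \<in> Q" "((k', i'), (k, i)) = ?up w"
          using up[OF *(2,1) *(3,4)[symmetric] 2] by (rule bexE)
        then have "((k, i), (k', i')) = ?dn w" by (auto split: prod.splits)
        then show ?thesis using v \<open>w \<in> Q\<close> by blast
      next
        case 3
        then have "a i = a i'" using * by (simp add: f_def)
        then have "i = i'" using amono(2)[of i i'] amono(2)[of i' i] * by (auto simp: X_def)
        then show ?thesis using 3 * v by auto
      qed
    qed
    then have "card ?E \<le> card ((\<lambda>y. (y, y)) ` X \<union> (?up ` Q \<union> ?dn ` Q))"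
      using fin finQ by (intro card_mono) auto
    also have "\<dots> \<le> card ((\<lambda>y. (y, y)) ` X) + (card (?up ` Q) + card (?dn ` Q))"
      by (intro order_trans[OF card_Un_le] add_mono order_refl card_Un_le)
    also have "\<dots> \<le> card X + (card Q + card Q)"
      using fin finQ by (intro add_mono card_image_le)
    also have "card X \<le> N\<^sup>2"
      by (simp add: X_def card_cartesian_product power2_eq_square mult_le_mono)
    finally show "card ?E \<le> N\<^sup>2 + 2 * card Q" by simp
  qed
  finally show ?thesis unfolding Q_def .
qed

section \<open>Increments of a function whose derivative is increasing and concave\<close>

locale concave_derivative =
  fixes F F' F'' F''' :: "real \<Rightarrow> real"
  assumes dF: "x \<ge> 1 \<Longrightarrow> (F has_real_derivative F' x) (at x within {1..})"
    and dF': "x \<ge> 1 \<Longrightarrow> (F' has_real_derivative F'' x) (at x within {1..})"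
    and dF'': "x \<ge> 1 \<Longrightarrow> (F'' has_real_derivative F''' x) (at x within {1..})"
    and F'_pos: "x \<ge> 1 \<Longrightarrow> F' x > 0"
    and F''_pos: "x \<ge> 1 \<Longrightarrow> F'' x > 0"
    and F'''_neg: "x \<ge> 1 \<Longrightarrow> F''' x < 0"

lemma MVT_within:
  fixes f f' :: "real \<Rightarrow> real"
  assumes "a < b" "\<And>x. x \<in> {a..b} \<Longrightarrow> (f has_real_derivative f' x) (at x within {a..b})"
  obtains z where "a < z" "z < b" "f b - f a = (b - a) * f' z"
proof -
  have "\<exists>x\<in>{a<..<b}. f b - f a = (\<lambda>h. f' x * h) (b - a)"
    using assms by (intro mvt_simple) (auto simp: has_field_derivative_def)
  then show ?thesis using that by (auto simp: mult.commute)
qed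

lemma MVT_ray:
  fixes f f' :: "real \<Rightarrow> real"
  assumes "\<And>x. x \<ge> 1 \<Longrightarrow> (f has_real_derivative f' x) (at x within {1..})" "1 \<le> x" "x < y"
  obtains z where "x < z" "z < y" "f y - f x = (y - x) * f' z"
proof (rule MVT_within[OF assms(3), of f f'])
  fix t assume "t \<in> {x..y}"
  then show "(f has_real_derivative f' t) (at t within {x..y})"
    using assms(2) by (intro DERIV_subset[OF assms(1)]) auto
qed (rule that)

context concave_derivative begin

lemma F''_antimono:
  assumes "1 \<le> x" "x \<le> y"
  shows "F'' y \<le> F'' x"
proof (cases "x = y")
  case False
  with assms(2) have xy: "x < y" by simp
  obtain z where z: "x < z" "z < y" "F'' y - F'' x = (y - x) * F''' z"
    by (rule MVT_ray[OF dF'' assms(1) xy])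
  have "(y - x) * F''' z \<le> 0"
    using F'''_neg[of z] z assms by (intro mult_nonneg_nonpos) auto
  with z show ?thesis by simp
qed simp

lemma F'_diff_ge:
  assumes "1 \<le> x" "x \<le> y"
  shows "(y - x) * F'' y \<le> F' y - F' x"
proof (cases "x = y")
  case False
  with assms(2) have xy: "x < y" by simp
  obtain z where z: "x < z" "z < y" "F' y - F' x = (y - x) * F'' z"
    by (rule MVT_ray[OF dF' assms(1) xy])
  show ?thesis using z F''_antimono[of z y] assms by (simp add: mult_left_mono)
qed simp

lemma F'_diff_le:
  assumes "1 \<le> x" "x \<le> y"
  shows "F' y - F' x \<le> (y - x) * F'' x"
proof (cases "x = y")
  case False
  with assms(2) have xy: "x < y" by simp
  obtain z where z: "x < z" "z < y" "F' y - F' x = (y - x) * F'' z"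
    by (rule MVT_ray[OF dF' assms(1) xy])
  show ?thesis using z F''_antimono[of x z] assms by (simp add: mult_left_mono)
qed simp

lemma F'_mono:
  assumes "1 \<le> x" "x \<le> y"
  shows "F' x \<le> F' y"
proof -
  have "0 \<le> (y - x) * F'' y"
    using F''_pos[of y] assms by (intro mult_nonneg_nonneg) auto
  with F'_diff_ge[OF assms] show ?thesis by linarith
qed

lemma F_diff:
  assumes "1 \<le> x" "x < y"
  obtains z where "x < z" "z < y" "F y - F x = (y - x) * F' z"
  using MVT_ray[OF dF assms] by blast

text \<open>Quantitative convexity, from the mean value theorem for \<open>F (t + q) - F t\<close>.
  Its derivative \<open>F' (t + q) - F' t\<close> is at least \<open>q * F'' (t + q)\<close>, and
  \<open>F''\<close> decreases.\<close>

lemma F_increment_growth: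
  assumes "1 \<le> x" "x \<le> y" "0 \<le> q"
  shows "(y - x) * (q * F'' (y + q)) \<le> (F (y + q) - F y) - (F (x + q) - F x)"
proof (cases "x = y")
  case False
  have "((\<lambda>t. F (t + q) - F t) has_real_derivative (F' (t + q) * 1 - F' t)) (at t within {x..y})" if t: "t \<in> {x..y}" for t
  proof (rule DERIV_diff)
    have "(F \<circ> (\<lambda>t. t + q) has_real_derivative F' (t + q) * 1) (at t within {x..y})"
      using t assms by (intro DERIV_image_chain DERIV_subset[OF dF]) (auto intro!: derivative_eq_intros)
    then show "((\<lambda>t. F (t + q)) has_real_derivative F' (t + q) * 1) (at t within {x..y})"
      by (simp add: o_def)
    show "(F has_real_derivative F' t) (at t within {x..y})"
      using t assms by (intro DERIV_subset[OF dF]) auto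
  qed
  moreover have "x < y" using False assms by simp
  ultimately obtain z where z: "x < z" "z < y" "(F (y + q) - F y) - (F (x + q) - F x) = (y - x) * (F' (z + q) * 1 - F' z)"
    using MVT_within[of x y "\<lambda>t. F (t + q) - F t" "\<lambda>t. F' (t + q) * 1 - F' t"] by blast
  have "q * F'' (y + q) \<le> q * F'' (z + q)"
    using z assms by (intro mult_left_mono F''_antimono) auto
  also have "\<dots> \<le> F' (z + q) - F' z"
    using F'_diff_ge[of z "z + q"] z assms by simp
  finally show ?thesis using z assms by (simp add: mult_left_mono)
qed simp

text \<open>When the floors have increment \<open>m\<close>, the increment of \<open>F\<close> lies
  within distance 1 of \<open>m\<close>. Two such increments thus differ by at most 2, and
  \<open>F_increment_growth\<close> confines every \<open>i\<close> to a short interval starting at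
  the smallest one.\<close>

lemma card_floor_increment_le:
  assumes q: "q \<ge> 1" and N: "N \<ge> 1"
  shows "real (card {i. 0 < i \<and> i + q \<le> N \<and> \<lfloor>F (real (i + q))\<rfloor> - \<lfloor>F (real i)\<rfloor> = m}) \<le> 1 + 2 / (real q * F'' (real N))"
    (is "real (card ?X) \<le> _")
proof (cases "?X = {}")
  case True
  show ?thesis unfolding True using F''_pos[of "real N"] assms by simp
next
  case False
  have fin: "finite ?X" by (rule finite_subset[of _ "{..N}"]) auto
  define j where "j = Min ?X"
  have j: "j \<in> ?X" unfolding j_def using fin False by (rule Min_in)
  let ?t = "2 / (real q * F'' (real N))"
  have pos: "real q * F'' (real N) > 0" using q N F''_pos[of "real N"] by simp
  have "?X \<subseteq> {j..j + nat \<lfloor>?t\<rfloor>}"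
  proof
    fix i assume i: "i \<in> ?X"
    have ji: "j \<le> i" unfolding j_def using fin i by (rule Min_le)
    have "(real i - real j) * (real q * F'' (real N)) \<le> (real i - real j) * (real q * F'' (real i + real q))"
      using i j ji N by (intro mult_left_mono F''_antimono) auto
    also have "\<dots> \<le> (F (real i + real q) - F (real i)) - (F (real j + real q) - F (real j))"
      using ji j by (intro F_increment_growth) auto
    also have "\<dots> \<le> 2" using i j by simp linarith
    finally have "real i - real j \<le> ?t" unfolding pos_le_divide_eq[OF pos] .
    then have "real (i - j) \<le> ?t" using ji by (simp add: of_nat_diff)
    then have "i - j \<le> nat \<lfloor>?t\<rfloor>" by linarith
    then show "i \<in> {j..j + nat \<lfloor>?t\<rfloor>}" using ji by simp
  qed
  then have "card ?X \<le> card {j..j + nat \<lfloor>?t\<rfloor>}" by (intro card_mono) auto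
  then have "real (card ?X) \<le> 1 + real (nat \<lfloor>?t\<rfloor>)" by simp
  also have "\<dots> \<le> 1 + ?t" using pos by (simp add: divide_nonneg_pos)
  finally show ?thesis .
qed

text \<open>Fixing \<open>p\<close>, \<open>q\<close> and \<open>k\<close> fixes the common
  difference, so \<open>card_floor_increment_le\<close> counts the possible \<open>i\<close>.
  Summation over \<open>q\<close> produces a harmonic sum, hence the logarithm.\<close>

lemma card_short_gap_coincidences_le:
  assumes N: "N \<ge> 1" and P: "P \<le> N"
  shows "real (card (short_gap_coincidences (\<lambda>n. \<lfloor>F (real n)\<rfloor>) M N P))
     \<le> real N * (real P)\<^sup>2 + 2 * real N * real P * (1 + ln (real N)) / F'' (real N)"
proof -
  define a where "a n = \<lfloor>F (real n)\<rfloor>" for n :: nat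
  define X where "X q m = {i. 0 < i \<and> i + q \<le> N \<and> a (i + q) - a i = m}" for q m
  define \<delta> where "\<delta> = F'' (real N)"
  have \<delta>: "\<delta> > 0" unfolding \<delta>_def using N by (intro F''_pos) auto
  have finX: "finite (X q m)" for q m unfolding X_def by (rule finite_subset[of _ "{..N}"]) auto
  let ?A = "SIGMA p:{1..<P}. SIGMA q:{1..<P}. SIGMA k:{1..N}. X q (a (k + p) - a k)"
  have "short_gap_coincidences a M N P \<subseteq> (\<lambda>(p, q, k, i). ((p, q), k, i)) ` ?A"
    by (force simp: short_gap_coincidences_def X_def image_iff)
  then have "card (short_gap_coincidences a M N P) \<le> card ((\<lambda>(p, q, k, i). ((p, q), k, i)) ` ?A)"
    using finX by (intro card_mono) auto
  also have "\<dots> \<le> card ?A" using finX by (intro card_image_le) auto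
  also have "\<dots> = (\<Sum>p\<in>{1..<P}. \<Sum>q\<in>{1..<P}. \<Sum>k\<in>{1..N}. card (X q (a (k + p) - a k)))"
    using finX by simp
  finally have "real (card (short_gap_coincidences a M N P)) \<le> 
     real (\<Sum>p\<in>{1..<P}. \<Sum>q\<in>{1..<P}. \<Sum>k\<in>{1..N}. card (X q (a (k + p) - a k)))"
    by (rule of_nat_mono)
  also have "\<dots> = (\<Sum>p\<in>{1..<P}. \<Sum>q\<in>{1..<P}. \<Sum>k\<in>{1..N}. real (card (X q (a (k + p) - a k))))"
    by simp
  also have "\<dots> \<le> (\<Sum>p\<in>{1..<P}. \<Sum>q\<in>{1..<P}. \<Sum>k\<in>{1..N}. 1 + 2 / (real q * \<delta>))"
    unfolding X_def a_def \<delta>_def using N by (intro sum_mono card_floor_increment_le) auto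
  also have "\<dots> = (\<Sum>p\<in>{1..<P}. \<Sum>q\<in>{1..<P}. real N * (1 + (2 / \<delta>) * (1 / real q)))"
    by (simp add: mult.commute)
  also have "\<dots> = real (P - 1) * (real N * (\<Sum>q\<in>{1..<P}. 1 + (2 / \<delta>) * (1 / real q)))"
    by (simp only: sum_distrib_left[symmetric] sum_constant card_atLeastLessThan) (simp only: mult_ac)
  also have "(\<Sum>q\<in>{1..<P}. 1 + (2 / \<delta>) * (1 / real q)) = real (P - 1) + (2 / \<delta>) * (\<Sum>q\<in>{1..<P}. 1 / real q)"
    by (simp only: sum.distrib sum_distrib_left) simp
  also have "real (P - 1) * (real N * (real (P - 1) + (2 / \<delta>) * (\<Sum>q\<in>{1..<P}. 1 / real q))) \<le>
     real P * (real N * (real P + (2 / \<delta>) * (1 + ln (real N))))"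
  proof -
    have "(\<Sum>q\<in>{1..<P}. 1 / real q) \<le> (\<Sum>q\<in>{1..N}. 1 / real q)"
      using P by (intro sum_mono2) auto
    also have "\<dots> = harm N" by (simp add: harm_def inverse_eq_divide)
    also have "\<dots> \<le> 1 + ln (real N)" using decseqD[OF decseq_harm_diff_ln, of 0 "N - 1"] N by (simp add: harm_expand)
    finally show ?thesis using \<delta>
      by (intro mult_mono add_mono mult_left_mono add_nonneg_nonneg mult_nonneg_nonneg sum_nonneg) auto
  qed
  also have "\<dots> = real N * (real P)\<^sup>2 + 2 * real N * real P * (1 + ln (real N)) / \<delta>"
    by (simp add: algebra_simps power2_eq_square)
  finally show ?thesis unfolding a_def \<delta>_def .
qed

text \<open>With about \<open>N / P\<close> labels, the energy is of order
  \<open>N ^ 3 / P + N\<^sup>2 P + N\<^sup>2 ln N / F'' N\<close>. Taking \<open>P\<close> close to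
  the square root of \<open>N\<close> balances the first two terms.\<close>

lemma additive_energy_floor_le:
  assumes N: "N \<ge> 4" and mono: "strict_mono_on {M<..N} (\<lambda>n. \<lfloor>F (real n)\<rfloor>)"
  defines "X \<equiv> {M<..N} \<times> {M<..N}"
  shows "real (card {(y, z) \<in> X \<times> X. \<lfloor>F (real (fst y))\<rfloor> + \<lfloor>F (real (snd y))\<rfloor> = \<lfloor>F (real (fst z))\<rfloor> + \<lfloor>F (real (snd z))\<rfloor>})
     \<le> 27 * real N powr (5 / 2) + 24 * (real N)\<^sup>2 * (1 + ln (real N)) / F'' (real N)"
proof -
  define r where "r = sqrt (real N)"
  have r2: "r\<^sup>2 = real N" by (simp add: r_def)
  \<comment> \<open>From \<open>r \<ge> 2\<close> follows
    \<open>P \<le> 2 r \<le> r\<^sup>2 = N\<close>, as the count of coincidences requires.\<close>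
  have r: "r \<ge> 2" unfolding r_def using N by (intro real_le_rsqrt) auto
  define P where "P = nat \<lceil>r\<rceil>"
  have P: "r \<le> real P" "real P \<le> 2 * r" unfolding P_def using r by linarith+
  have "real P \<le> r * r" using mult_right_mono[of 2 r r] P(2) r by linarith
  then have PN: "P \<le> N" using r2 by (simp add: power2_eq_square)
  define C where "C = short_gap_coincidences (\<lambda>n. \<lfloor>F (real n)\<rfloor>) M N P"
  let ?E = "{(y, z) \<in> X \<times> X. \<lfloor>F (real (fst y))\<rfloor> + \<lfloor>F (real (snd y))\<rfloor> = \<lfloor>F (real (fst z))\<rfloor> + \<lfloor>F (real (snd z))\<rfloor>}"
  define u where "u = (1 + ln (real N)) / F'' (real N)"
  have u: "u \<ge> 0" unfolding u_def using N F''_pos[of "real N"] by simp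
  have "card ?E \<le> (2 * (N div P) + 1) * (N\<^sup>2 + 2 * card C)"
    unfolding X_def C_def using P r by (intro additive_energy_le mono) auto
  then have "real (card ?E) \<le> real ((2 * (N div P) + 1) * (N\<^sup>2 + 2 * card C))"
    by (rule of_nat_mono)
  also have "\<dots> = (2 * real (N div P) + 1) * ((real N)\<^sup>2 + 2 * real (card C))"
    by (simp add: algebra_simps)
  also have "\<dots> \<le> (3 * r) * ((real N)\<^sup>2 + 2 * (real N * (2 * r)\<^sup>2 + 2 * real N * (2 * r) * u))"
  proof (intro mult_mono add_mono mult_left_mono order_refl)
    have "real (N div P) \<le> real N / real P" by (rule of_nat_div_le_of_nat)
    also have "\<dots> \<le> real N / r" using P r by (intro divide_left_mono mult_pos_pos) auto
    also have "\<dots> = r" using r r2 by (simp add: power2_eq_square field_simps)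
    finally show "2 * real (N div P) + 1 \<le> 3 * r" using r by linarith
    have "real (card C) \<le> real N * (real P)\<^sup>2 + 2 * real N * real P * u"
      using card_short_gap_coincidences_le[OF _ PN, of M] N by (simp add: C_def u_def)
    also have "\<dots> \<le> real N * (2 * r)\<^sup>2 + 2 * real N * (2 * r) * u"
      using P u by (intro add_mono mult_left_mono mult_right_mono power_mono) auto
    finally show "real (card C) \<le> real N * (2 * r)\<^sup>2 + 2 * real N * (2 * r) * u" .
  qed (use r in auto)
  also have "\<dots> = 27 * (r * (real N)\<^sup>2) + 24 * (r\<^sup>2 * real N) * u"
    by (simp add: r2[symmetric]) (simp add: algebra_simps power_numeral_reduce)
  also have "r * (real N)\<^sup>2 = real N powr (5 / 2)"
    using N powr_add[of "real N" "1/2" 2] by (simp add: r_def powr_half_sqrt powr_numeral)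
  also have "24 * (r\<^sup>2 * real N) * u = 24 * (real N)\<^sup>2 * (1 + ln (real N)) / F'' (real N)"
    unfolding r2 u_def by (simp add: power2_eq_square)
  finally show ?thesis .
qed

end

section \<open>Lower bounds for the mean of the exponential sum\<close>

lemma integral_norm_exp_sum_ge_1:
  assumes "N \<ge> 1"
  shows "(\<integral>x. norm (exp_sum a N x) \<partial>cell c) \<ge> 1"
proof -
  have "real N \<le> real (card {(j, l) \<in> {1..N} \<times> {1..N}. a j = a l})"
  proof -
    have "card ((\<lambda>j. (j, j)) ` {1..N}) \<le> card {(j, l) \<in> {1..N} \<times> {1..N}. a j = a l}"
      by (intro card_mono) (auto intro: finite_subset[of _ "{1..N} \<times> {1..N}"])
    then show ?thesis by (subst (asm) card_image) (auto simp: inj_on_def)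
  qed
  also have "\<dots> = (\<integral>x. (norm (exp_sum a N x))\<^sup>2 \<partial>cell c)"
    unfolding exp_sum_def by (rule integral_norm_square_ee_sum[symmetric]) simp
  also have "\<dots> \<le> (\<integral>x. real N * norm (exp_sum a N x) \<partial>cell c)"
    using norm_exp_sum_le[of a N]
    by (intro integral_mono integrable_cell continuous_intros) (auto simp: power2_eq_square mult_right_mono)
  also have "\<dots> = real N * (\<integral>x. norm (exp_sum a N x) \<partial>cell c)" by simp
  finally show ?thesis using assms by simp
qed

text \<open>The pointwise inequality \<open>s\<^sup>2 \<le> \<Lambda> s + s\<^sup>4 / \<Lambda>\<^sup>2\<close> replaces Hoelder's inequality here.\<close>

lemma card_le_L1_plus_energy:
  fixes a :: "nat \<Rightarrow> int" and \<Lambda> :: real and J :: "nat set"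
  assumes "\<Lambda> > 0" and J: "finite J"
  shows "real (card J) \<le> \<Lambda> * (\<integral>x. norm (\<Sum>n\<in>J. ee (a n) x) \<partial>cell c) +
    real (card {(y, z) \<in> (J \<times> J) \<times> (J \<times> J). a (fst y) + a (snd y) = a (fst z) + a (snd z)}) / \<Lambda>\<^sup>2"
proof -
  define S where "S x = (\<Sum>n\<in>J. ee (a n) x)" for x
  have contS: "continuous_on A S" for A unfolding S_def by (intro continuous_intros)
  have S2: "(S x)\<^sup>2 = (\<Sum>y\<in>J \<times> J. ee (a (fst y) + a (snd y)) x)" for x
    by (simp add: S_def power2_eq_square sum_product sum.cartesian_product case_prod_unfold ee_add)
  have pt: "(norm (S x))\<^sup>2 \<le> \<Lambda> * norm (S x) + (norm ((S x)\<^sup>2))\<^sup>2 / \<Lambda>\<^sup>2" for x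
  proof (cases "norm (S x) \<le> \<Lambda>")
    case True
    then have "(norm (S x))\<^sup>2 \<le> \<Lambda> * norm (S x)" by (simp add: power2_eq_square mult_right_mono)
    then show ?thesis by (simp add: add_increasing2)
  next
    case False
    have "(norm (S x))\<^sup>2 * 1 \<le> (norm (S x))\<^sup>2 * ((norm (S x))\<^sup>2 / \<Lambda>\<^sup>2)"
      using False assms by (intro mult_left_mono) (auto intro!: power_mono)
    also have "\<dots> = (norm ((S x)\<^sup>2))\<^sup>2 / \<Lambda>\<^sup>2" by (simp add: norm_mult power2_eq_square)
    finally show ?thesis using assms by (simp add: add_increasing)
  qed
  have "card ((\<lambda>j. (j, j)) ` J) \<le> card {(j, l) \<in> J \<times> J. a j = a l}"
    using J by (intro card_mono) (auto intro: finite_subset[of _ "J \<times> J"])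
  then have "real (card J) \<le> real (card {(j, l) \<in> J \<times> J. a j = a l})"
    by (subst (asm) card_image) (auto simp: inj_on_def)
  also have "\<dots> = (\<integral>x. (norm (S x))\<^sup>2 \<partial>cell c)"
    unfolding S_def by (rule integral_norm_square_ee_sum[symmetric, OF J])
  also have "\<dots> \<le> (\<integral>x. \<Lambda> * norm (S x) + (norm ((S x)\<^sup>2))\<^sup>2 / \<Lambda>\<^sup>2 \<partial>cell c)"
    using assms by (intro integral_mono integrable_cell continuous_intros contS pt) auto
  also have "\<dots> = (\<integral>x. \<Lambda> * norm (S x) \<partial>cell c) + (\<integral>x. (norm ((S x)\<^sup>2))\<^sup>2 / \<Lambda>\<^sup>2 \<partial>cell c)"
    using assms by (intro Bochner_Integration.integral_add integrable_cell continuous_intros contS) auto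
  also have "\<dots> = \<Lambda> * (\<integral>x. norm (S x) \<partial>cell c) + (\<integral>x. (norm ((S x)\<^sup>2))\<^sup>2 \<partial>cell c) / \<Lambda>\<^sup>2"
    by simp
  also have "(\<integral>x. (norm ((S x)\<^sup>2))\<^sup>2 \<partial>cell c) =
      real (card {(y, z) \<in> (J \<times> J) \<times> (J \<times> J). a (fst y) + a (snd y) = a (fst z) + a (snd z)})"
    unfolding S2 using J by (intro integral_norm_square_ee_sum) auto
  finally show ?thesis unfolding S_def .
qed

context concave_derivative begin

text \<open>Since \<open>F''\<close> decreases, \<open>F'\<close> grows at most linearly and
  \<open>F\<close> at most quadratically. This bounds the degree of the exponential sum polynomially
  in \<open>N\<close>.\<close>

lemma abs_floor_F_le:
  obtains A0 :: nat where "A0 > 0" "\<And>n N. 1 \<le> n \<Longrightarrow> n \<le> N \<Longrightarrow> \<bar>\<lfloor>F (real n)\<rfloor>\<bar> \<le> int (A0 * N\<^sup>2)"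
proof -
  define B where "B = \<bar>F 1\<bar> + F' 1 + F'' 1"
  have pos: "F' 1 > 0" "F'' 1 > 0" by (auto intro: F'_pos F''_pos)
  define A0 where "A0 = nat \<lceil>B\<rceil> + 1"
  show ?thesis
  proof (rule that)
    show "A0 > 0" by (simp add: A0_def)
    fix n N :: nat assume n: "1 \<le> n" "n \<le> N"
    have N1: "1 \<le> real N" "real N \<le> (real N)\<^sup>2" "1 \<le> (real N)\<^sup>2"
      using n by (auto simp: power2_eq_square intro: mult_ge1_I)
    have "\<bar>F (real n) - F 1\<bar> \<le> (real N)\<^sup>2 * (F' 1 + F'' 1)"
    proof (cases "n = 1")
      case True
      then show ?thesis using pos by simp
    next
      case False
      with n have "1 < real n" by simp
      then obtain z where z: "1 < z" "z < real n" "F (real n) - F 1 = (real n - 1) * F' z"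
        using F_diff[of 1 "real n"] by auto
      have "F' z \<le> F' 1 + (z - 1) * F'' 1" using F'_diff_le[of 1 z] z by simp
      also have "\<dots> \<le> real N * F' 1 + real N * F'' 1"
      proof (intro add_mono mult_right_mono)
        show "F' 1 \<le> real N * F' 1" using pos N1 by simp
      qed (use z n pos in auto)
      finally have "F' z \<le> real N * (F' 1 + F'' 1)" by (simp add: ring_distribs)
      moreover have "F' z > 0" using z by (intro F'_pos) auto
      ultimately have "(real n - 1) * F' z \<le> real N * (real N * (F' 1 + F'' 1))"
        using n by (intro mult_mono) auto
      then show ?thesis using z n \<open>F' z > 0\<close> by (simp add: power2_eq_square mult.assoc)
    qed
    then have "\<bar>F (real n)\<bar> \<le> \<bar>F 1\<bar> + (real N)\<^sup>2 * (F' 1 + F'' 1)" by linarith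
    also have "\<dots> \<le> (real N)\<^sup>2 * \<bar>F 1\<bar> + (real N)\<^sup>2 * (F' 1 + F'' 1)"
      using N1 by (intro add_mono order_refl) (simp add: mult_le_cancel_right1)
    also have "\<dots> = (real N)\<^sup>2 * B" by (simp add: B_def ring_distribs)
    finally have "\<bar>of_int \<lfloor>F (real n)\<rfloor>\<bar> \<le> (real N)\<^sup>2 * B + (real N)\<^sup>2 * 1" using N1 by linarith
    also have "\<dots> = (real N)\<^sup>2 * (B + 1)" by (simp add: ring_distribs)
    also have "\<dots> \<le> (real N)\<^sup>2 * real A0" unfolding A0_def by (intro mult_left_mono) (linarith, simp)
    finally have "real_of_int \<bar>\<lfloor>F (real n)\<rfloor>\<bar> \<le> real_of_int (int (A0 * N\<^sup>2))" by (simp add: mult.commute)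
    then show "\<bar>\<lfloor>F (real n)\<rfloor>\<bar> \<le> int (A0 * N\<^sup>2)" by (simp only: of_int_le_iff)
  qed
qed

text \<open>\<open>F'\<close> increases, so beyond \<open>M\<close> every unit step adds at least 1
  to \<open>F\<close>, which moves the floor.\<close>

lemma strict_mono_on_floor:
  assumes "M \<ge> 1" "F' (real M) \<ge> 1"
  shows "strict_mono_on {M<..N} (\<lambda>n. \<lfloor>F (real n)\<rfloor>)"
proof (rule strict_mono_onI)
  fix x y assume xy: "x \<in> {M<..N}" "y \<in> {M<..N}" "x < y"
  then obtain z where z: "real x < z" "z < real y" "F (real y) - F (real x) = (real y - real x) * F' z"
    using F_diff[of "real x" "real y"] assms by auto
  have "F' (real M) \<le> F' z" using z xy assms by (intro F'_mono) auto
  then have "1 * 1 \<le> (real y - real x) * F' z"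
    using xy assms by (intro mult_mono) auto
  then show "\<lfloor>F (real x)\<rfloor> < \<lfloor>F (real y)\<rfloor>" using z by linarith
qed

text \<open>Beyond \<open>M\<close> the energy is \<open>O(N powr (3 - 2 * \<tau>))\<close>: the
  term \<open>N powr (5 / 2)\<close> is absorbed by \<open>\<tau> \<le> 1 / 4\<close>, and
  \<open>2 * \<tau> - 1 < \<sigma>\<close> leaves room for the logarithm. In
  \<open>card_le_L1_plus_energy\<close> a multiple of \<open>N powr (1 - \<tau>)\<close> is the
  right \<open>\<Lambda>\<close> for this energy.\<close>

lemma integral_norm_exp_sum_ge:
  fixes \<sigma> \<tau> :: real
  assumes \<sigma>: "\<sigma> > -1" and ev: "eventually (\<lambda>N. F'' (real N) \<ge> real N powr \<sigma>) sequentially"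
    and \<tau>: "0 < \<tau>" "\<tau> \<le> 1 / 4" "2 * \<tau> - 1 < \<sigma>"
  obtains c\<^sub>0 N\<^sub>0 where "0 < c\<^sub>0" "c\<^sub>0 \<le> 1"
    "\<And>c N. N \<ge> N\<^sub>0 \<Longrightarrow> (\<integral>x. norm (exp_sum (\<lambda>n. \<lfloor>F (real n)\<rfloor>) N x) \<partial>cell c) \<ge> c\<^sub>0 * real N powr \<tau>"
proof -
  define a where "a n = \<lfloor>F (real n)\<rfloor>" for n :: nat
  have powr_large: "eventually (\<lambda>N::nat. real N powr p \<ge> B) sequentially" if "p > 0" for p B :: real
    using eventually_ge_at_top[of "nat \<lceil>max B 1 powr (1 / p)\<rceil>"]
  proof eventually_elim
    case (elim N)
    have "B \<le> (max B 1 powr (1 / p)) powr p" using that by (simp add: powr_powr)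
    also have "\<dots> \<le> real N powr p" using elim that by (intro powr_mono2) (auto simp: nat_le_iff ceiling_le_iff)
    finally show ?case .
  qed
  \<comment> \<open>Here \<open>\<sigma> > -1\<close> enters: for large \<open>n\<close>,
    \<open>F' (2 n)\<close> is at least
    \<open>n * F'' (2 n) \<ge> (2 n) powr (1 + \<sigma>) / 2\<close>, which is unbounded.\<close>
  obtain M where M: "M \<ge> 1" "F' (real M) \<ge> 1"
  proof -
    have \<sigma>0: "1 + \<sigma> > 0" using \<sigma> by simp
    have "eventually (\<lambda>N. real N powr (1 + \<sigma>) \<ge> 2 \<and> F'' (real N) \<ge> real N powr \<sigma>) sequentially"
      using ev powr_large[OF \<sigma>0, of 2] by eventually_elim auto
    then obtain N0 where N0: "\<And>N. N \<ge> N0 \<Longrightarrow> real N powr (1 + \<sigma>) \<ge> 2 \<and> F'' (real N) \<ge> real N powr \<sigma>"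
      by (auto simp: eventually_sequentially)
    define n where "n = max N0 1"
    have n: "1 / 2 * (2 * real n) powr (1 + \<sigma>) \<ge> 1" "F'' (real (2 * n)) \<ge> real (2 * n) powr \<sigma>" "n \<ge> 1"
      using N0[of "2 * n"] by (auto simp: n_def)
    have "1 \<le> 1 / 2 * (2 * real n) powr (1 + \<sigma>)" by (rule n)
    also have "\<dots> = (real (2 * n) - real n) * real (2 * n) powr \<sigma>"
      using n by (simp add: powr_add)
    also have "\<dots> \<le> (real (2 * n) - real n) * F'' (real (2 * n))"
      using n by (intro mult_left_mono) auto
    also have "\<dots> \<le> F' (real (2 * n)) - F' (real n)"
      using n by (intro F'_diff_ge) auto
    also have "\<dots> \<le> F' (real (2 * n))" using F'_pos[of "real n"] n by simp
    finally show ?thesis using that[of "2 * n"] n by auto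
  qed
  \<comment> \<open>The spare exponent that absorbs the logarithm, through
    \<open>ln N \<le> N powr \<kappa> / \<kappa>\<close>.\<close>
  define \<kappa> where "\<kappa> = 1 + \<sigma> - 2 * \<tau>"
  have \<kappa>: "\<kappa> > 0" using \<tau> by (simp add: \<kappa>_def)
  define C where "C = 27 + 24 * (1 + 1 / \<kappa>)"
  have C: "C \<ge> 27" using \<kappa> by (simp add: C_def)
  \<comment> \<open>Chosen so that \<open>L\<^sup>2 = 4 * C\<close>: the energy term is then at most
    \<open>N / 4\<close>, half of the lower bound \<open>N / 2\<close> for
    \<open>card J\<close>.\<close>
  define L where "L = 2 * sqrt C"
  have L: "L \<ge> 2" using C by (simp add: L_def)
  have L2: "L\<^sup>2 = 4 * C" using C by (simp add: L_def power_mult_distrib)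
  \<comment> \<open>The first \<open>M\<close> terms of the sum contribute at most \<open>M\<close>;
    this threshold makes that at most half of the bound \<open>N powr \<tau> / (4 * L)\<close> for
    the rest.\<close>
  have "eventually (\<lambda>N. real N powr \<tau> \<ge> 8 * L * real M) sequentially"
    using \<tau> by (intro powr_large)
  then have "eventually (\<lambda>N. real N powr \<tau> \<ge> 8 * L * real M \<and> F'' (real N) \<ge> real N powr \<sigma> \<and> N \<ge> 2 * M \<and> N \<ge> 4) sequentially"
    using ev eventually_ge_at_top[of "2 * M"] eventually_ge_at_top[of 4] by eventually_elim auto
  then obtain N0 where N0: "\<And>N. N \<ge> N0 \<Longrightarrow> real N powr \<tau> \<ge> 8 * L * real M \<and> F'' (real N) \<ge> real N powr \<sigma> \<and> N \<ge> 2 * M \<and> N \<ge> 4"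
    by (auto simp: eventually_sequentially)
  show ?thesis
  proof (rule that)
    show "0 < 1 / (8 * L)" "1 / (8 * L) \<le> 1" using L by auto
    fix c :: int and N assume "N \<ge> N0"
    note N = N0[OF this]
    have Npos: "real N > 0" "real N \<ge> 1" using N by auto
    define J where "J = {M<..N}"
    have finJ: "finite J" by (simp add: J_def)
    define E where "E = real (card {(y, z) \<in> (J \<times> J) \<times> (J \<times> J). a (fst y) + a (snd y) = a (fst z) + a (snd z)})"
    define I where "I = (\<integral>x. norm (\<Sum>n\<in>J. ee (a n) x) \<partial>cell c)"
    define \<Lambda> where "\<Lambda> = L * real N powr (1 - \<tau>)"
    have \<Lambda>: "\<Lambda> > 0" using L Npos by (simp add: \<Lambda>_def)
    have E: "E \<le> C * real N powr (3 - 2 * \<tau>)"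
    proof -
      have "E \<le> 27 * real N powr (5 / 2) + 24 * (real N)\<^sup>2 * (1 + ln (real N)) / F'' (real N)"
        unfolding E_def J_def a_def using N M
        by (intro additive_energy_floor_le strict_mono_on_floor) auto
      also have "\<dots> \<le> 27 * real N powr (3 - 2 * \<tau>) + 24 * ((1 + 1 / \<kappa>) * real N powr (3 - 2 * \<tau>))"
      proof (intro add_mono)
        show "27 * real N powr (5 / 2) \<le> 27 * real N powr (3 - 2 * \<tau>)"
          using Npos \<tau> by (intro mult_left_mono powr_mono) auto
        have "1 + ln (real N) \<le> real N powr \<kappa> + real N powr \<kappa> / \<kappa>"
          using Npos \<kappa> by (intro add_mono ln_powr_bound ge_one_powr_ge_zero) auto
        then have ln: "1 + ln (real N) \<le> (1 + 1 / \<kappa>) * real N powr \<kappa>" by (simp add: ring_distribs)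
        have "(real N)\<^sup>2 * (1 + ln (real N)) / F'' (real N) \<le>
            (real N)\<^sup>2 * ((1 + 1 / \<kappa>) * real N powr \<kappa>) / real N powr \<sigma>"
          using Npos \<kappa> N ln by (intro frac_le mult_left_mono) auto
        also have "\<dots> = (1 + 1 / \<kappa>) * (real N powr 2 * real N powr \<kappa> / real N powr \<sigma>)"
          using Npos by (simp add: powr_numeral)
        also have "real N powr 2 * real N powr \<kappa> / real N powr \<sigma> = real N powr (3 - 2 * \<tau>)"
          unfolding powr_add[symmetric] powr_diff[symmetric] by (simp add: \<kappa>_def)
        finally show "24 * (real N)\<^sup>2 * (1 + ln (real N)) / F'' (real N) \<le> 24 * ((1 + 1 / \<kappa>) * real N powr (3 - 2 * \<tau>))"
          by simp
      qed
      also have "\<dots> = C * real N powr (3 - 2 * \<tau>)" by (simp add: C_def ring_distribs)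
      finally show ?thesis .
    qed
    have "E / \<Lambda>\<^sup>2 \<le> C * real N powr (3 - 2 * \<tau>) / \<Lambda>\<^sup>2"
      by (intro divide_right_mono E) auto
    also have "\<dots> = real N / 4"
    proof -
      have "\<Lambda>\<^sup>2 = 4 * C * real N powr (2 - 2 * \<tau>)"
        using Npos by (simp add: \<Lambda>_def power_mult_distrib L2 powr_power)
      then have "C * real N powr (3 - 2 * \<tau>) / \<Lambda>\<^sup>2 = (real N powr (3 - 2 * \<tau>) / real N powr (2 - 2 * \<tau>)) / 4"
        using C by simp
      also have "\<dots> = real N / 4" using Npos by (simp flip: powr_diff)
      finally show ?thesis .
    qed
    finally have "E / \<Lambda>\<^sup>2 \<le> real N / 4" .
    then have "real (card J) \<le> \<Lambda> * I + real N / 4"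
      using card_le_L1_plus_energy[OF \<Lambda> finJ, where a = a and c = c]
      unfolding E_def I_def by linarith
    moreover have "real (card J) \<ge> real N / 2" using N by (simp add: J_def)
    ultimately have "real N / 4 \<le> \<Lambda> * I" by linarith
    then have "real N / (4 * \<Lambda>) \<le> I" using \<Lambda> by (simp add: field_simps)
    moreover have "real N / (4 * \<Lambda>) = real N powr \<tau> / (4 * L)"
      using Npos L by (simp add: \<Lambda>_def powr_diff field_simps)
    ultimately have I: "real N powr \<tau> / (4 * L) \<le> I" by simp
    have "I \<le> (\<integral>x. norm (exp_sum a N x) + real M \<partial>cell c)"
      unfolding I_def
    proof (intro integral_mono integrable_cell continuous_intros)
      fix x
      have "{1..N} = {1..M} \<union> J" using N by (auto simp: J_def)
      then have "exp_sum a N x = exp_sum a M x + (\<Sum>n\<in>J. ee (a n) x)"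
        unfolding exp_sum_def by (auto simp: J_def intro!: sum.union_disjoint)
      then have "(\<Sum>n\<in>J. ee (a n) x) = exp_sum a N x - exp_sum a M x" by simp
      then show "norm (\<Sum>n\<in>J. ee (a n) x) \<le> norm (exp_sum a N x) + real M"
        using norm_triangle_ineq4[of "exp_sum a N x" "exp_sum a M x"] norm_exp_sum_le[of a M x] by simp
    qed
    also have "\<dots> = (\<integral>x. norm (exp_sum a N x) \<partial>cell c) + (\<integral>x. real M \<partial>cell c)"
      by (intro Bochner_Integration.integral_add integrable_cell continuous_intros)
    also have "(\<integral>x. real M \<partial>cell c) = real M" by simp
    finally have "real N powr \<tau> / (4 * L) - real M \<le> (\<integral>x. norm (exp_sum a N x) \<partial>cell c)" using I by linarith
    moreover have "real M \<le> real N powr \<tau> / (8 * L)" using N L by (simp add: field_simps)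
    moreover have "real N powr \<tau> / (4 * L) = 2 * (real N powr \<tau> / (8 * L))" by simp
    ultimately have "real N powr \<tau> / (8 * L) \<le> (\<integral>x. norm (exp_sum a N x) \<partial>cell c)" by linarith
    then show "1 / (8 * L) * real N powr \<tau> \<le> (\<integral>x. norm (exp_sum (\<lambda>n. \<lfloor>F (real n)\<rfloor>) N x) \<partial>cell c)"
      unfolding a_def by (simp only: mult_1_left times_divide_eq_left)
  qed
qed

end

section \<open>Growth exponents and the choice of parameters\<close>

lemma io_Omega_mono:
  assumes "io_Omega f g" "\<And>N. g' N \<le> g N"
  shows "io_Omega f g'"
proof -
  from assms(1) obtain c where c: "c > 0" "infinite {N. f N \<ge> c * g N}" by (auto simp: io_Omega_def)
  have "{N. f N \<ge> c * g N} \<subseteq> {N. f N \<ge> c * g' N}"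
    using c(1) assms(2) by (smt (verit) Collect_mono_iff mult_left_mono)
  with c show ?thesis unfolding io_Omega_def using infinite_super by blast
qed

text \<open>Any number below a limit inferior is eventually exceeded; for \<open>N \<ge> 2\<close>
  the logarithm of \<open>N\<close> is positive, and the quotient can be cleared and
  exponentiated.\<close>

lemma powr_le_of_growth_exponent:
  fixes G :: "real \<Rightarrow> real"
  assumes "ereal \<sigma> < growth_exponent G" and pos: "\<And>x. x \<ge> 1 \<Longrightarrow> G x > 0"
  shows "eventually (\<lambda>N. G (real N) \<ge> real N powr \<sigma>) sequentially"
proof -
  have "eventually (\<lambda>N::nat. ereal \<sigma> < ereal (ln (G (real N)) / ln (real N))) sequentially"
    using assms(1) unfolding growth_exponent_def by (rule less_LiminfD)
  then show ?thesis using eventually_ge_at_top[of 2]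
  proof eventually_elim
    case (elim N)
    have "real N powr \<sigma> = exp (\<sigma> * ln (real N))" using elim by (simp add: powr_def)
    also have "\<dots> \<le> exp (ln (G (real N)))" using elim by (simp add: field_simps)
    also have "\<dots> = G (real N)" using elim pos[of "real N"] by simp
    finally show ?case .
  qed
qed

lemma nat_powr_ereal_mono:
  assumes "\<epsilon> \<le> \<delta>" "e < \<infinity>"
  shows "nat_powr_ereal N (e - ereal \<delta>) \<le> nat_powr_ereal N (e - ereal \<epsilon>)"
proof (cases e)
  case (real t)
  show ?thesis
  proof (cases "N = 0")
    case False
    then show ?thesis using assms real by (simp add: nat_powr_ereal_def powr_mono)
  qed (simp add: nat_powr_ereal_def)
qed (use assms in \<open>auto simp: nat_powr_ereal_def\<close>)

theorem theorem3:
  fixes F F' F'' F''' :: "real \<Rightarrow> real" and a :: "nat \<Rightarrow> int" and \<rho> :: ereal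
  assumes "\<And>x. x \<ge> 1 \<Longrightarrow> (F has_real_derivative F' x) (at x within {1..})"
    and "\<And>x. x \<ge> 1 \<Longrightarrow> (F' has_real_derivative F'' x) (at x within {1..})"
    and "\<And>x. x \<ge> 1 \<Longrightarrow> (F'' has_real_derivative F''' x) (at x within {1..})"
    and "continuous_on {1..} F'''"
    and "\<And>x. x \<ge> 1 \<Longrightarrow> F' x > 0"
    and "\<And>x. x \<ge> 1 \<Longrightarrow> F'' x > 0"
    and "\<And>x. x \<ge> 1 \<Longrightarrow> F''' x < 0"
    and "\<And>n. n \<ge> 1 \<Longrightarrow> a n = \<lfloor>F (real n)\<rfloor>"
    and "\<rho> = growth_exponent F''"
  shows "AE \<alpha> in lborel. \<forall>\<epsilon>>0.
           io_Omega (\<lambda>N. real N * star_discrepancy N (\<lambda>n. frac (of_int (a n) * \<alpha>)))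
                    (\<lambda>N. nat_powr_ereal N (min (1/4) ((1 + \<rho>) / 2) - ereal \<epsilon>))"
proof -
  interpret concave_derivative F F' F'' F'''
    using assms(1-3,5-7) by unfold_locales
  define e where "e = min (1/4) ((1 + \<rho>) / 2)"
  let ?ND = "\<lambda>\<alpha> N. real N * star_discrepancy N (\<lambda>n. frac (of_int (a n) * \<alpha>))"
  have e14: "e \<le> ereal (1 / 4)" unfolding e_def by (rule min.coboundedI1) (simp add: numeral_eq_ereal one_ereal_def)
  then have e_fin: "e < \<infinity>" by (rule le_less_trans) simp
  obtain A0 where A0: "A0 > 0" "\<And>n N. 1 \<le> n \<Longrightarrow> n \<le> N \<Longrightarrow> \<bar>a n\<bar> \<le> int (A0 * N\<^sup>2)"
    using abs_floor_F_le assms(8) by metis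
  have exp_sum_a: "exp_sum a N = exp_sum (\<lambda>n. \<lfloor>F (real n)\<rfloor>) N" for N
    unfolding exp_sum_def using assms(8) by (intro ext sum.cong) auto
  have main: "AE \<alpha> in lborel. io_Omega (?ND \<alpha>) (\<lambda>N. nat_powr_ereal N (e - ereal \<epsilon>))"
    if \<epsilon>: "0 < \<epsilon>" "\<epsilon> \<le> 1" for \<epsilon>
  proof (cases e)
    case (real t)
    \<comment> \<open>Half of \<open>\<epsilon>\<close> is spent here, to leave
      \<open>\<tau> < t\<close> when \<open>\<tau>\<close> is positive; the other half goes into
      \<open>4 * \<eta>\<close> with \<open>\<eta> = \<epsilon> / 8\<close>. The maximum provides
      \<open>\<tau> \<ge> 0\<close> and can only strengthen the bound.\<close>
    define \<tau> where "\<tau> = max 0 (t - \<epsilon> / 2)"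
    have "\<exists>c\<^sub>0 N\<^sub>0. 0 < c\<^sub>0 \<and> c\<^sub>0 \<le> 1 \<and>
      (\<forall>c N. N \<ge> N\<^sub>0 \<longrightarrow> (\<integral>x. norm (exp_sum a N x) \<partial>cell c) \<ge> c\<^sub>0 * real N powr \<tau>)"
    proof (cases "t - \<epsilon> / 2 \<le> 0")
      \<comment> \<open>Exponent 0: the mean square is at least \<open>N\<close> and the sum never
        exceeds \<open>N\<close>, so the mean of its absolute value is at least 1.\<close>
      case True
      then have "\<tau> = 0" by (simp add: \<tau>_def)
      then show ?thesis using integral_norm_exp_sum_ge_1[where a = a]
        by (intro exI[of _ 1]) auto
    next
      case False
      then have \<tau>: "\<tau> = t - \<epsilon> / 2" "0 < \<tau>" "\<tau> < t" using \<epsilon> by (auto simp: \<tau>_def)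
      have t14: "t \<le> 1 / 4" using e14 real by simp
      have "ereal t \<le> (1 + \<rho>) / 2" using real unfolding e_def by (metis min.cobounded2)
      \<comment> \<open>There is room for \<open>\<sigma>\<close> because
        \<open>2 * \<tau> - 1 < 2 * t - 1 \<le> \<rho>\<close>.\<close>
      then have "\<exists>\<sigma>. 2 * \<tau> - 1 < \<sigma> \<and> ereal \<sigma> < \<rho>"
      proof (cases \<rho>)
        case (real r)
        with \<open>ereal t \<le> (1 + \<rho>) / 2\<close> have "t \<le> (1 + r) / 2"
          by (simp add: one_ereal_def numeral_eq_ereal)
        then show ?thesis using \<tau> real by (intro exI[of _ "(2 * \<tau> - 1 + r) / 2"]) auto
      next
        case PInf
        then show ?thesis using lt_ex gt_ex by auto
      next
        case MInf
        with \<open>ereal t \<le> (1 + \<rho>) / 2\<close> show ?thesis by (simp add: one_ereal_def numeral_eq_ereal)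
      qed
      then obtain \<sigma> where \<sigma>: "2 * \<tau> - 1 < \<sigma>" "ereal \<sigma> < growth_exponent F''" using assms(9) by blast
      have "eventually (\<lambda>N. F'' (real N) \<ge> real N powr \<sigma>) sequentially"
        using \<sigma>(2) F''_pos by (rule powr_le_of_growth_exponent)
      moreover have "\<sigma> > -1" "\<tau> \<le> 1 / 4" using \<sigma> \<tau> t14 by auto
      ultimately obtain c0 N0 where "0 < c0" "c0 \<le> 1" and
        "\<And>c N. N \<ge> N0 \<Longrightarrow> (\<integral>x. norm (exp_sum a N x) \<partial>cell c) \<ge> c0 * real N powr \<tau>"
        using integral_norm_exp_sum_ge[of \<sigma> \<tau>] \<sigma>(1) \<tau>(2) unfolding exp_sum_a by metis
      then show ?thesis by blast
    qed
    then obtain c0 N0 where c0: "0 < c0" "c0 \<le> 1"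
      "\<And>c N. N \<ge> N0 \<Longrightarrow> (\<integral>x. norm (exp_sum a N x) \<partial>cell c) \<ge> c0 * real N powr \<tau>" by blast
    have "AE \<alpha> in lborel. io_Omega (?ND \<alpha>) (\<lambda>N. real N powr (\<tau> - 4 * (\<epsilon> / 8)))"
      using \<epsilon> c0 A0 by (intro AE_io_Omega_of_L1[where c\<^sub>0 = c0 and ?A0.0 = A0 and N\<^sub>0 = N0]) (auto simp: \<tau>_def)
    then show ?thesis
    proof eventually_elim
      case (elim \<alpha>)
      show ?case
      proof (rule io_Omega_mono[OF elim])
        fix N
        show "nat_powr_ereal N (e - ereal \<epsilon>) \<le> real N powr (\<tau> - 4 * (\<epsilon> / 8))"
          by (cases "N = 0") (auto simp: real nat_powr_ereal_def \<tau>_def intro!: powr_mono)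
      qed
    qed
  next
    \<comment> \<open>The comparison function is identically 0, so nonnegativity of the discrepancy
      is enough.\<close>
    case MInf
    have "?ND \<alpha> N \<ge> 0" for \<alpha> N
      using star_discrepancy_nonneg[of N] by (cases "N = 0") auto
    then have "io_Omega (?ND \<alpha>) (\<lambda>N. nat_powr_ereal N (e - ereal \<epsilon>))" for \<alpha>
      unfolding io_Omega_def by (intro exI[of _ 1]) (simp add: MInf nat_powr_ereal_def)
    then show ?thesis by simp
  qed (use e_fin in auto)
  \<comment> \<open>Null sets may be united over countably many exponents only; the values
    \<open>1 / (m + 1)\<close> lie in the range that \<open>main\<close> allows, and monotonicity
    recovers every other \<open>\<epsilon>\<close>.\<close>
  have "AE \<alpha> in lborel. \<forall>m::nat. io_Omega (?ND \<alpha>) (\<lambda>N. nat_powr_ereal N (e - ereal (1 / real (Suc m))))"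
    unfolding AE_all_countable by (intro allI main) auto
  then show ?thesis
  proof eventually_elim
    case (elim \<alpha>)
    show ?case
    proof (intro allI impI)
      fix \<epsilon> :: real assume "\<epsilon> > 0"
      then obtain m where m: "1 / real (Suc m) < \<epsilon>" using nat_approx_posE by blast
      show "io_Omega (?ND \<alpha>) (\<lambda>N. nat_powr_ereal N (min (1/4) ((1 + \<rho>) / 2) - ereal \<epsilon>))"
        unfolding e_def[symmetric]
        using m e_fin by (intro io_Omega_mono[OF elim[rule_format, of m]] nat_powr_ereal_mono) auto
    qed
  qed
qed

end
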